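(* Let $\Lambda'$ be any subset of $\Lambda$ obtained by deleting $2N$ elements. Then $\Lambda'$ can be reparametrized as $$\Lambda'=\bigcup_{j=0}^N\{\lambda_m^{(j)}\}_{m\in\mathbb K},$$ where for each $j$, $$\Big|\lambda_m^{(j)}-\frac{\pi m}{\ell_j}\Big|=O(|m|^{-1}).$$
   Context: $N\ge1$, $0=a_0<a_1<\cdots<a_N<a_{N+1}=\ell$, $M_j>0$ for $1\le j\le N$, $\ell_j=a_{j+1}-a_j$ for $j=0,\dots,N$, $\mathbb K=\{\pm1,\pm2,\dots\}$. The potential $q$ is real and its restriction $q_j$ to $(a_j,a_{j+1})$ extends to $C[a_j,a_{j+1}]$ for $j=0,1,2$ and to $C^{j-2}[a_j,a_{j+1}]$ for $j>2$. Eigenvalue problem: $-\phi''+q\phi=\lambda^2\phi$ on $(0,\ell)\setminus\{a_1,\dots,a_N\}$; $\phi(0)=\phi(\ell)=0$; $\phi(a_j^-)=\phi(a_j^+)$ and $\phi'(a_j^+)=\phi'(a_j^-)-M_j\lambda^2\phi(a_j)$ for $j=1,\dots,N$. Its eigenvalues $\lambda^2$ are real and simple; they are listed in increasing order as $\{(\lambda_n)^2\}_{n\ge1}$. The eigenfrequencies $\Lambda=\{\lambda_n:n\in\mathbb K\}$ are defined, for $n\geq 1$, by: $\lambda_{n}>0$ and $\lambda_{-n}=-\lambda_n$ if $(\lambda_n)^2>0$; $\lambda_{\pm n}=\pm i\sqrt{|\lambda_n|^2}$ if $(\lambda_n)^2<0$; $\lambda_n=\lambda_{-n}=0$ if $(\lambda_n)^2=0$.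 $\Lambda$ is regarded as a family indexed by $\mathbb K$ (so $0$, if present, is counted twice), and "reparametrized" means that the family $\Lambda'$ is put in bijection with the index set $\{0,\dots,N\}\times\mathbb K$. *)

theory Defs
  imports Complex_Main "HOL-Library.Landau_Symbols"
begin

text \<open>Derivatives are taken within \<open>S\<close>, hence one-sided at the endpoints of a closed interval.\<close>

definition Ck_on :: "nat \<Rightarrow> real set \<Rightarrow> (real \<Rightarrow> real) \<Rightarrow> bool" where
  "Ck_on k S f \<longleftrightarrow>
     (\<exists>D. (\<forall>x\<in>S. D 0 x = f x) \<and>
          (\<forall>i<k. \<forall>x\<in>S. (D i has_real_derivative D (Suc i) x) (at x within S)) \<and>
          continuous_on S (D k))"

text \<open>
  The masses \<open>M j\<close> sit at \<open>a j\<close> for \<open>j = 1, \<dots>, N\<close>; values of \<open>a\<close> beyond \<open>Suc N\<close>, of \<open>M\<close> outside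
  \<open>{1..N}\<close> and of \<open>q\<close> at the points \<open>a j\<close> are irrelevant.  The exponent \<open>j - 2\<close> is truncated
  subtraction, so it asks for mere continuity on the intervals \<open>j = 0, 1, 2\<close>.
\<close>

definition loaded_string ::
    "nat \<Rightarrow> (nat \<Rightarrow> real) \<Rightarrow> real \<Rightarrow> (nat \<Rightarrow> real) \<Rightarrow> (real \<Rightarrow> real) \<Rightarrow> bool" where
  "loaded_string N a L M q \<longleftrightarrow>
     1 \<le> N \<and> a 0 = 0 \<and> a (Suc N) = L \<and> (\<forall>j\<le>N. a j < a (Suc j)) \<and>
     (\<forall>j\<in>{1..N}. 0 < M j) \<and>
     (\<forall>j\<le>N. \<exists>g. Ck_on (j - 2) {a j..a (Suc j)} g \<and> (\<forall>x\<in>{a j<..<a (Suc j)}. g x = q x))"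

text \<open>
  \<open>\<mu>\<close> stands for \<open>\<lambda>\<^sup>2\<close>.  Both \<open>\<mu>\<close> and the eigenfunction are allowed to be complex.  Continuity of
  \<open>\<phi>\<close> on \<open>{0..L}\<close> expresses the matching of its one-sided limits at each \<open>a j\<close>; the jump condition
  includes the existence of the one-sided limits of the derivative \<open>\<psi>\<close>.
\<close>

definition eigenfunction ::
    "nat \<Rightarrow> (nat \<Rightarrow> real) \<Rightarrow> real \<Rightarrow> (nat \<Rightarrow> real) \<Rightarrow> (real \<Rightarrow> real) \<Rightarrow> complex \<Rightarrow>
     (real \<Rightarrow> complex) \<Rightarrow> bool" where
  "eigenfunction N a L M q \<mu> \<phi> \<longleftrightarrow>
     (\<exists>x\<in>{0..L}. \<phi> x \<noteq> 0) \<and> continuous_on {0..L} \<phi> \<and> \<phi> 0 = 0 \<and> \<phi> L = 0 \<and>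
     (\<exists>\<psi> \<chi>.
        (\<forall>x \<in> {0<..<L} - a ` {1..N}.
           (\<phi> has_vector_derivative \<psi> x) (at x) \<and>
           (\<psi> has_vector_derivative \<chi> x) (at x) \<and>
           - \<chi> x + of_real (q x) * \<phi> x = \<mu> * \<phi> x) \<and>
        (\<forall>j\<in>{1..N}. \<exists>dl dr.
           (\<psi> \<longlongrightarrow> dl) (at_left (a j)) \<and> (\<psi> \<longlongrightarrow> dr) (at_right (a j)) \<and>
           dr = dl - of_real (M j) * \<mu> * \<phi> (a j)))"

definition eigenvalues ::
    "nat \<Rightarrow> (nat \<Rightarrow> real) \<Rightarrow> real \<Rightarrow> (nat \<Rightarrow> real) \<Rightarrow> (real \<Rightarrow> real) \<Rightarrow> complex set" where
  "eigenvalues N a L M q = {\<mu>. \<exists>\<phi>. eigenfunction N a L M q \<mu> \<phi>}"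

text \<open>
  \<open>ev n\<close>, \<open>n \<ge> 1\<close>, is the strictly increasing list of the (real) eigenvalues; each eigenvalue occurs
  once because the eigenspaces are one-dimensional.  At most one sequence on \<open>{1..}\<close> has this
  property.
\<close>

definition lists_eigenvalues ::
    "nat \<Rightarrow> (nat \<Rightarrow> real) \<Rightarrow> real \<Rightarrow> (nat \<Rightarrow> real) \<Rightarrow> (real \<Rightarrow> real) \<Rightarrow> (nat \<Rightarrow> real) \<Rightarrow> bool" where
  "lists_eigenvalues N a L M q ev \<longleftrightarrow>
     strict_mono_on {1..} ev \<and> eigenvalues N a L M q = (\<lambda>n. complex_of_real (ev n)) ` {1..}"

definition \<K> :: "int set" where
  "\<K> = UNIV - {0}"

text \<open>The case \<open>ev n = 0\<close> is covered by the first branch, giving \<open>0\<close> at both \<open>n\<close> and \<open>- n\<close>.\<close>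

definition eigenfrequency :: "(nat \<Rightarrow> real) \<Rightarrow> int \<Rightarrow> complex" where
  "eigenfrequency ev k =
     (let \<mu> = ev (nat \<bar>k\<bar>)
      in of_int (sgn k) *
         (if 0 \<le> \<mu> then of_real (sqrt \<mu>) else \<i> * of_real (sqrt \<bar>\<mu>\<bar>)))"

end

theory Submission
  imports Defs "HOL-Analysis.Analysis"
begin

text \<open>
  Idea: let \<open>\<theta>\<close> be the Pruefer angle of the solution with \<open>\<phi>(0) = 0\<close>, so that \<open>\<phi> = \<rho> sin \<theta>\<close>,
  \<open>\<phi>' = \<rho> cos \<theta>\<close>.  A mass acts on the angle as the flow of \<open>\<theta>' = M \<mu> (sin \<theta>)\<^sup>2\<close> for unit time, so
  strings and masses are instances of the single equation \<open>\<theta>' = p (cos \<theta>)\<^sup>2 + v (sin \<theta>)\<^sup>2\<close>.  The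
  total angle at the right end is continuous and strictly increasing in \<open>\<mu>\<close>, positive, and below \<open>pi\<close>
  for very negative \<open>\<mu>\<close>; hence it equals \<open>n pi\<close> exactly at the \<open>n\<close>-th eigenvalue.

  For \<open>\<mu> = R\<^sup>2\<close> with \<open>R\<close> large, the rescaled angle advances by \<open>R \<ell>\<^sub>j + O(1/R)\<close> over the \<open>j\<close>-th
  string, and each mass then pushes it up to within \<open>O(1/R)\<close> of the next multiple of \<open>pi\<close>.  So if every
  \<open>R \<ell>\<^sub>j\<close> is at distance at least \<open>C/R\<close> from the multiples of \<open>pi\<close>, exactly
  \<open>N + (\<Sum>j. \<lfloor>R \<ell>\<^sub>j / pi\<rfloor>)\<close> eigenvalues lie below \<open>R\<^sup>2\<close>.  Such \<open>R\<close> exist within \<open>O(1/x)\<close> of every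
  large \<open>x\<close>, so the \<open>(N + k)\<close>-th frequency is \<open>O(1/k)\<close>-close to the \<open>k\<close>-th element of the sorted family
  \<open>pi m / \<ell>\<^sub>j\<close>.  Changing the set of \<open>2 N\<close> deleted indices alters only finitely many matches.
\<close>

text \<open>Mean value theorem. Differentiability is asked for in the open interval and continuity
  up to the ends, which is what a solution on a single string provides.\<close>

lemma nondecreasing_if_deriv_nonneg_interior:
  fixes f :: "real \<Rightarrow> real"
  assumes "a \<le> b" "continuous_on {a..b} f"
    and "\<And>t. a < t \<Longrightarrow> t < b \<Longrightarrow> (f has_real_derivative f' t) (at t)"
    and "\<And>t. a < t \<Longrightarrow> t < b \<Longrightarrow> 0 \<le> f' t"
  shows "f a \<le> f b"
proof (cases "a = b")
  case False
  with assms(1) have "a < b" by simp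
  then obtain z where z: "a < z" "z < b" "f b - f a = (b - a) * f' z"
    using mvt[of a b f "\<lambda>t h. f' t * h"] assms(2,3)
    unfolding has_field_derivative_def by (metis mult.commute)
  then have "0 \<le> f b - f a"
    using assms(4)[of z] \<open>a < b\<close> by simp
  then show ?thesis by simp
qed simp

section \<open>Scalar differential equations with a globally Lipschitz right-hand side\<close>

text \<open>Freezing \<open>g\<close> at its end values outside \<open>{a..b}\<close> turns it into
  an element of the complete space \<open>real \<Rightarrow>\<^sub>C real\<close>, which thus plays
  the role of the continuous functions on \<open>{a..b}\<close>.\<close>

lemma bcontfun_clamp:
  fixes g :: "real \<Rightarrow> real"
  assumes "a \<le> b" "continuous_on {a..b} g"
  shows "(\<lambda>x. g (max a (min b x))) \<in> bcontfun"
proof -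
  have "continuous_on UNIV (\<lambda>x. g (max a (min b x)))"
    by (rule continuous_on_compose2[OF assms(2)]) (auto intro!: continuous_intros simp: assms(1))
  moreover have "bounded (range (\<lambda>x. g (max a (min b x))))"
    by (rule bounded_subset[OF compact_imp_bounded[OF compact_continuous_image[OF assms(2)]]])
      (auto simp: assms(1))
  ultimately show ?thesis by (simp add: bcontfun_def)
qed

text \<open>
  The weight \<open>exp (2 * k * (t - a))\<close> makes the Picard operator a contraction on the whole interval,
  so that no continuation argument is needed.
\<close>

lemma global_Lipschitz_ode_exists:
  fixes f :: "real \<Rightarrow> real \<Rightarrow> real"
  assumes ab: "a \<le> b"
    and cont: "\<And>y. continuous_on {a..b} y \<Longrightarrow> continuous_on {a..b} (\<lambda>t. f t (y t))"
    and lip: "\<And>t y z. t \<in> {a..b} \<Longrightarrow> \<bar>f t y - f t z\<bar> \<le> K * \<bar>y - z\<bar>"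
  obtains y where "y a = c" "continuous_on {a..b} y"
    "\<And>t. t \<in> {a..b} \<Longrightarrow> (y has_real_derivative f t (y t)) (at t within {a..b})"
proof -
  define k where "k = \<bar>K\<bar> + 1"
  define E where "E t = exp (2 * k * (t - a))" for t
  have k: "k > 0" by (simp add: k_def)
  have lipk: "\<bar>f t y - f t z\<bar> \<le> k * \<bar>y - z\<bar>" if "t \<in> {a..b}" for t y z
  proof -
    have "K * \<bar>y - z\<bar> \<le> k * \<bar>y - z\<bar>" unfolding k_def by (intro mult_right_mono) auto
    with lip[OF that, of y z] show ?thesis by linarith
  qed
  have Epos: "E t > 0" for t by (simp add: E_def)
  have contE: "continuous_on S E" for S unfolding E_def by (intro continuous_intros)
  \<comment> \<open>The fixed point is sought for \<open>g = y / E\<close> rather than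
    \<open>y\<close>: the sup norm of \<open>g\<close> is then the weighted norm of
    \<open>y\<close>.\<close>
  define I where "I g x = integral {a..x} (\<lambda>s. f s (E s * apply_bcontfun g s))" for g :: "real \<Rightarrow>\<^sub>C real" and x
  have contI: "continuous_on {a..b} (\<lambda>s. f s (E s * apply_bcontfun g s))" for g :: "real \<Rightarrow>\<^sub>C real"
    by (rule cont) (intro continuous_intros contE continuous_on_apply_bcontfun)
  have derI: "(I g has_real_derivative f x (E x * apply_bcontfun g x)) (at x within {a..b})"
    if "x \<in> {a..b}" for g x
    unfolding I_def by (rule integral_has_real_derivative[OF contI that])
  define T where "T g x = (c + I g x) / E x" for g :: "real \<Rightarrow>\<^sub>C real" and x
  have contIg: "continuous_on {a..b} (I g)" for g
    by (rule DERIV_continuous_on[OF derI])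
  have contT: "continuous_on {a..b} (T g)" for g
    unfolding T_def by (intro continuous_intros contIg contE) (use Epos in \<open>auto simp: less_imp_neq[symmetric]\<close>)
  define P where "P g = Bcontfun (\<lambda>x. T g (max a (min b x)))" for g
  have P: "apply_bcontfun (P g) x = T g (max a (min b x))" for g x
    unfolding P_def by (subst Bcontfun_inverse[OF bcontfun_clamp[OF ab contT]]) simp
  have derE: "((\<lambda>s. E s / (2 * k)) has_real_derivative E s) (at s within A)" for s A
    unfolding E_def using k by (auto intro!: derivative_eq_intros)
  \<comment> \<open>The integral of \<open>k * E\<close> up to \<open>x\<close> is at most
    \<open>E x / 2\<close>; dividing by \<open>E x\<close> in \<open>T\<close> leaves the
    contraction constant 1/2, whatever the length of the interval.\<close>
  have diff: "\<bar>I g x - I h x\<bar> \<le> dist g h * E x / 2" if x: "x \<in> {a..b}" for g h x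
  proof -
    have sub: "{a..x} \<subseteq> {a..b}" using x by auto
    have int: "(\<lambda>s. f s (E s * apply_bcontfun g s)) integrable_on {a..x}" for g
      by (rule integrable_continuous_real[OF continuous_on_subset[OF contI sub]])
    have Eint: "(E has_integral (E x / (2 * k) - E a / (2 * k))) {a..x}"
      by (rule fundamental_theorem_of_calculus)
        (use x derE in \<open>auto simp flip: has_real_derivative_iff_has_vector_derivative\<close>)
    have "\<bar>I g x - I h x\<bar> = \<bar>integral {a..x} (\<lambda>s. f s (E s * apply_bcontfun g s) - f s (E s * apply_bcontfun h s))\<bar>"
      unfolding I_def by (simp add: integral_diff int)
    also have "\<dots> \<le> integral {a..x} (\<lambda>s. k * dist g h * E s)"
      unfolding real_norm_def[symmetric]
    proof (rule integral_norm_bound_integral)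
      show "(\<lambda>s. k * dist g h * E s) integrable_on {a..x}"
        using has_integral_mult_right[OF Eint] by blast
      fix s assume s: "s \<in> {a..x}"
      have "\<bar>f s (E s * apply_bcontfun g s) - f s (E s * apply_bcontfun h s)\<bar>
          \<le> k * \<bar>E s * apply_bcontfun g s - E s * apply_bcontfun h s\<bar>"
        using lipk s sub by blast
      also have "\<dots> = k * (E s * dist (apply_bcontfun g s) (apply_bcontfun h s))"
        using Epos[of s] by (simp add: dist_real_def abs_mult flip: right_diff_distrib)
      also have "\<dots> \<le> k * (E s * dist g h)"
        using k Epos[of s] dist_bounded[of g s h] by (intro mult_left_mono) auto
      finally show "norm (f s (E s * apply_bcontfun g s) - f s (E s * apply_bcontfun h s)) \<le> k * dist g h * E s"
        by (simp add: mult_ac)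
    qed (intro integrable_diff int)
    also have "\<dots> = k * dist g h * (E x / (2 * k) - E a / (2 * k))"
      using has_integral_mult_right[OF Eint] by (rule integral_unique)
    also have "\<dots> = dist g h * (E x - E a) / 2"
      using k by (simp add: field_simps)
    also have "\<dots> \<le> dist g h * E x / 2"
      using Epos[of a] by (intro divide_right_mono mult_left_mono) auto
    finally show ?thesis .
  qed
  have "\<exists>!g. P g = g"
  proof (rule banach_fix_type[of "1/2"]; (intro allI)?)
    fix g h
    show "dist (P g) (P h) \<le> 1 / 2 * dist g h"
    proof (rule dist_bound)
      fix x
      define x' where "x' = max a (min b x)"
      have x': "x' \<in> {a..b}" using ab by (auto simp: x'_def)
      have "dist (apply_bcontfun (P g) x) (apply_bcontfun (P h) x) = \<bar>I g x' - I h x'\<bar> / E x'"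
        using Epos[of x'] unfolding P x'_def[symmetric] T_def dist_real_def
        by (simp add: abs_divide flip: diff_divide_distrib)
      also have "\<dots> \<le> (dist g h * E x' / 2) / E x'"
        using diff[OF x'] Epos[of x'] by (intro divide_right_mono) auto
      finally show "dist (apply_bcontfun (P g) x) (apply_bcontfun (P h) x) \<le> 1 / 2 * dist g h"
        using Epos[of x'] by simp
    qed
  qed auto
  then obtain g where g: "P g = g" by blast
  define y where "y x = E x * apply_bcontfun g x" for x
  have y: "y x = c + I g x" if "x \<in> {a..b}" for x
  proof -
    have "apply_bcontfun g x = T g x"
      using P[of g x] that by (simp add: g max_absorb2 min_absorb2)
    then show ?thesis using Epos[of x] by (simp add: y_def T_def)
  qed
  show ?thesis
  proof
    show "y a = c" using y[of a] ab by (simp add: I_def)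
    show der: "(y has_real_derivative f t (y t)) (at t within {a..b})" if "t \<in> {a..b}" for t
    proof -
      have "((\<lambda>x. c + I g x) has_real_derivative f t (E t * apply_bcontfun g t)) (at t within {a..b})"
        using derI[OF that, of g] by (auto intro!: derivative_eq_intros)
      then show ?thesis
        unfolding y_def[symmetric]
        by (rule has_field_derivative_transform_within[of _ _ _ _ 1]) (use y that in auto)
    qed
    show "continuous_on {a..b} y" by (rule DERIV_continuous_on[OF der])
  qed
qed

text \<open>Suppose \<open>d = z - y\<close> is negative at \<open>t\<close>, and let
  \<open>s\<close> be the last earlier time with \<open>d s \<ge> 0\<close>. After \<open>s\<close>
  the Lipschitz bound gives d' \<ge> K d, so \<open>d r * exp (- K * r)\<close> is nondecreasing
  from a nonnegative to a negative value, a contradiction.\<close>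

lemma ode_comparison:
  fixes y z :: "real \<Rightarrow> real"
  assumes y: "continuous_on {a..b} y" "\<And>t. a < t \<Longrightarrow> t < b \<Longrightarrow> (y has_real_derivative y' t) (at t)"
    and z: "continuous_on {a..b} z" "\<And>t. a < t \<Longrightarrow> t < b \<Longrightarrow> (z has_real_derivative z' t) (at t)"
    and sub: "\<And>t. a < t \<Longrightarrow> t < b \<Longrightarrow> y' t \<le> f t (y t)"
    and super: "\<And>t. a < t \<Longrightarrow> t < b \<Longrightarrow> f t (z t) \<le> z' t"
    and lip: "\<And>t u w. a < t \<Longrightarrow> t < b \<Longrightarrow> \<bar>f t u - f t w\<bar> \<le> K * \<bar>u - w\<bar>"
    and init: "y a \<le> z a" and t: "t \<in> {a..b}"
  shows "y t \<le> z t"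
proof (rule ccontr)
  assume neg: "\<not> y t \<le> z t"
  define d where "d s = z s - y s" for s
  have dcont: "continuous_on {a..b} d" unfolding d_def by (intro continuous_intros y z)
  define S where "S = {s \<in> {a..t}. d s \<ge> 0}"
  have "closed S"
    unfolding S_def using t
    by (intro continuous_closed_preimage_constant continuous_on_closed_Collect_le continuous_intros
        continuous_on_subset[OF dcont]) auto
  moreover have "S \<noteq> {}" using init t by (auto simp: S_def d_def)
  moreover have bdd: "bdd_above S" by (rule bdd_aboveI[of _ t]) (auto simp: S_def)
  ultimately have "Sup S \<in> S" by (intro closed_contains_Sup)
  define s where "s = Sup S"
  have s: "a \<le> s" "s \<le> t" "d s \<ge> 0" using \<open>Sup S \<in> S\<close> by (auto simp: S_def s_def)
  have dneg: "d r < 0" if "s < r" "r \<le> t" for r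
  proof (rule ccontr)
    assume "\<not> d r < 0"
    then have "r \<in> S" using that s by (auto simp: S_def)
    then have "r \<le> s" unfolding s_def by (rule cSup_upper[OF _ bdd])
    with that show False by simp
  qed
  have "d s * exp (- K * s) \<le> d t * exp (- K * t)"
  proof (rule nondecreasing_if_deriv_nonneg_interior[where f = "\<lambda>r. d r * exp (- K * r)"
        and f' = "\<lambda>r. (z' r - y' r - K * d r) * exp (- K * r)"])
    show "continuous_on {s..t} (\<lambda>r. d r * exp (- K * r))"
      by (intro continuous_intros continuous_on_subset[OF dcont]) (use s t in auto)
    fix r assume r: "s < r" "r < t"
    then have r': "a < r" "r < b" using s t by auto
    show "((\<lambda>r. d r * exp (- K * r)) has_real_derivative (z' r - y' r - K * d r) * exp (- K * r)) (at r)"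
      unfolding d_def by (rule derivative_eq_intros y(2) z(2) r' refl | simp add: algebra_simps)+
    have "z' r - y' r \<ge> f r (z r) - f r (y r)" using sub super r' by (smt (verit))
    moreover have "\<bar>f r (z r) - f r (y r)\<bar> \<le> K * (- d r)"
      using lip[OF r', of "z r" "y r"] dneg[of r] r by (simp add: d_def)
    ultimately show "0 \<le> (z' r - y' r - K * d r) * exp (- K * r)"
      by (intro mult_nonneg_nonneg) auto
  qed (use s in auto)
  moreover have "d t < 0" using neg by (simp add: d_def)
  ultimately show False using s(3)
    by (smt (verit) exp_gt_zero mult_neg_pos mult_nonneg_nonneg)
qed

text \<open>By comparison \<open>d = z - y\<close> is nonnegative, hence d' \<ge> - K d and
  \<open>d r * exp (K * r)\<close> is nondecreasing. A gap that is closed at \<open>b\<close> was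
  therefore never open.\<close>

lemma ode_separation:
  fixes y z :: "real \<Rightarrow> real"
  assumes y: "continuous_on {a..b} y" "\<And>t. a < t \<Longrightarrow> t < b \<Longrightarrow> (y has_real_derivative y' t) (at t)"
    and z: "continuous_on {a..b} z" "\<And>t. a < t \<Longrightarrow> t < b \<Longrightarrow> (z has_real_derivative z' t) (at t)"
    and sub: "\<And>t. a < t \<Longrightarrow> t < b \<Longrightarrow> y' t \<le> f t (y t)"
    and super: "\<And>t. a < t \<Longrightarrow> t < b \<Longrightarrow> f t (z t) \<le> z' t"
    and lip: "\<And>t u w. a < t \<Longrightarrow> t < b \<Longrightarrow> \<bar>f t u - f t w\<bar> \<le> K * \<bar>u - w\<bar>"
    and init: "y a \<le> z a" and t: "t \<in> {a..b}" and eq: "y b = z b"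
  shows "y t = z t"
proof -
  have le: "y r \<le> z r" if "r \<in> {a..b}" for r
    by (rule ode_comparison[OF y z sub super lip init that])
  define d where "d s = z s - y s" for s
  have dcont: "continuous_on {a..b} d" unfolding d_def by (intro continuous_intros y z)
  have "d t * exp (K * t) \<le> d b * exp (K * b)"
  proof (rule nondecreasing_if_deriv_nonneg_interior[where f = "\<lambda>r. d r * exp (K * r)"
        and f' = "\<lambda>r. (z' r - y' r + K * d r) * exp (K * r)"])
    show "continuous_on {t..b} (\<lambda>r. d r * exp (K * r))"
      by (intro continuous_intros continuous_on_subset[OF dcont]) (use t in auto)
    fix r assume r: "t < r" "r < b"
    then have r': "a < r" "r < b" using t by auto
    show "((\<lambda>r. d r * exp (K * r)) has_real_derivative (z' r - y' r + K * d r) * exp (K * r)) (at r)"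
      unfolding d_def by (rule derivative_eq_intros y(2) z(2) r' refl | simp add: algebra_simps)+
    have "z' r - y' r \<ge> f r (z r) - f r (y r)" using sub super r' by (smt (verit))
    moreover have "\<bar>f r (z r) - f r (y r)\<bar> \<le> K * d r"
      using lip[OF r', of "z r" "y r"] le[of r] r' by (simp add: d_def)
    ultimately show "0 \<le> (z' r - y' r + K * d r) * exp (K * r)"
      by (intro mult_nonneg_nonneg) auto
  qed (use t in auto)
  then have "d t * exp (K * t) \<le> 0" using eq by (simp add: d_def)
  then have "d t \<le> 0" by (simp add: mult_le_0_iff not_le)
  then show ?thesis using le[OF t] by (simp add: d_def)
qed

section \<open>The Pruefer equation\<close>

text \<open>On a string \<open>p\<close> is 1 and \<open>v\<close> is \<open>\<mu>\<close> minus the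
  potential; for a mass \<open>p\<close> is 0, \<open>v\<close> is the constant
  \<open>M * \<mu>\<close> and the interval is \<open>{0..1}\<close>.\<close>

definition prufer :: "real \<Rightarrow> (real \<Rightarrow> real) \<Rightarrow> real \<Rightarrow> real \<Rightarrow> (real \<Rightarrow> real) \<Rightarrow> bool" where
  "prufer p v a b \<theta> \<longleftrightarrow> continuous_on {a..b} \<theta> \<and>
     (\<forall>t\<in>{a<..<b}. (\<theta> has_real_derivative p * (cos (\<theta> t))\<^sup>2 + v t * (sin (\<theta> t))\<^sup>2) (at t))"

definition prufer_path :: "real \<Rightarrow> (real \<Rightarrow> real) \<Rightarrow> real \<Rightarrow> real \<Rightarrow> real \<Rightarrow> real \<Rightarrow> real" where
  "prufer_path p v a b c = (SOME \<theta>. prufer p v a b \<theta> \<and> \<theta> a = c)"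

abbreviation prufer_flow :: "real \<Rightarrow> (real \<Rightarrow> real) \<Rightarrow> real \<Rightarrow> real \<Rightarrow> real \<Rightarrow> real" where
  "prufer_flow p v a b c \<equiv> prufer_path p v a b c b"

text \<open>The difference of squares factors as \<open>sin (x + y) * sin (x - y)\<close>. The
  constant 1 makes a bound for \<open>v - p\<close> a Lipschitz constant of the Pruefer
  equation.\<close>

lemma abs_sin_squared_diff_le: "\<bar>(sin x)\<^sup>2 - (sin y)\<^sup>2\<bar> \<le> \<bar>x - y\<bar>" for x y :: real
proof -
  have "(sin x)\<^sup>2 - (sin y)\<^sup>2 = sin (x + y) * sin (x - y)"
  proof -
    have "sin (x + y) * sin (x - y) = (sin x)\<^sup>2 * (cos y)\<^sup>2 - (cos x)\<^sup>2 * (sin y)\<^sup>2"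
      by (simp add: sin_add sin_diff algebra_simps power2_eq_square)
    then show ?thesis by (simp add: cos_squared_eq algebra_simps)
  qed
  then have "\<bar>(sin x)\<^sup>2 - (sin y)\<^sup>2\<bar> = \<bar>sin (x + y)\<bar> * \<bar>sin (x - y)\<bar>" by (simp add: abs_mult)
  also have "\<dots> \<le> 1 * \<bar>x - y\<bar>"
    by (intro mult_mono abs_sin_x_le_abs_x abs_sin_le_one) auto
  finally show ?thesis by simp
qed

lemma prufer_rhs_eq: "p * (cos y)\<^sup>2 + v * (sin y)\<^sup>2 = p + (v - p) * (sin y)\<^sup>2" for p v y :: real
  by (simp add: cos_squared_eq algebra_simps)

lemma prufer_rhs_Lipschitz:
  fixes p v y z :: real
  assumes "\<bar>v - p\<bar> \<le> K"
  shows "\<bar>(p * (cos y)\<^sup>2 + v * (sin y)\<^sup>2) - (p * (cos z)\<^sup>2 + v * (sin z)\<^sup>2)\<bar> \<le> K * \<bar>y - z\<bar>"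
proof -
  have "\<bar>(p * (cos y)\<^sup>2 + v * (sin y)\<^sup>2) - (p * (cos z)\<^sup>2 + v * (sin z)\<^sup>2)\<bar>
      = \<bar>v - p\<bar> * \<bar>(sin y)\<^sup>2 - (sin z)\<^sup>2\<bar>"
    unfolding prufer_rhs_eq by (simp flip: abs_mult) (simp add: algebra_simps)
  also have "\<dots> \<le> K * \<bar>y - z\<bar>"
    using assms by (intro mult_mono abs_sin_squared_diff_le) auto
  finally show ?thesis .
qed

lemma continuous_on_bound:
  fixes v :: "real \<Rightarrow> real"
  assumes "continuous_on {a..b} v"
  obtains K where "K > 0" "\<And>t. t \<in> {a..b} \<Longrightarrow> \<bar>v t\<bar> \<le> K"
  using compact_imp_bounded[OF compact_continuous_image[OF assms compact_Icc]]
  unfolding bounded_pos by auto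

lemma continuous_on_bound_diff:
  fixes v :: "real \<Rightarrow> real"
  assumes "continuous_on {a..b} v"
  obtains K where "K > 0" "\<And>t. t \<in> {a..b} \<Longrightarrow> \<bar>v t - p\<bar> \<le> K"
proof -
  have "continuous_on {a..b} (\<lambda>t. v t - p)" by (intro continuous_intros assms)
  then show thesis by (rule continuous_on_bound) (rule that)
qed

lemma prufer_path:
  assumes "a \<le> b" "continuous_on {a..b} v"
  shows "prufer p v a b (prufer_path p v a b c)" and "prufer_path p v a b c a = c"
proof -
  obtain K where K: "\<And>t. t \<in> {a..b} \<Longrightarrow> \<bar>v t - p\<bar> \<le> K"
    using continuous_on_bound_diff[OF assms(2), where p = p] by blast
  obtain y where y: "y a = c" "continuous_on {a..b} y"
    "\<And>t. t \<in> {a..b} \<Longrightarrow>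
      (y has_real_derivative p * (cos (y t))\<^sup>2 + v t * (sin (y t))\<^sup>2) (at t within {a..b})"
  proof (rule global_Lipschitz_ode_exists[of a b "\<lambda>t y. p * (cos y)\<^sup>2 + v t * (sin y)\<^sup>2" K c])
    show "continuous_on {a..b} (\<lambda>t. p * (cos (y t))\<^sup>2 + v t * (sin (y t))\<^sup>2)"
      if "continuous_on {a..b} y" for y
      by (intro continuous_intros that assms)
  qed (use assms prufer_rhs_Lipschitz[OF K] in auto)
  have "prufer p v a b y"
    unfolding prufer_def
  proof (intro conjI ballI y)
    fix t assume t: "t \<in> {a<..<b}"
    have "at t within {a..b} = at t" by (rule at_within_interior) (use t in auto)
    then show "(y has_real_derivative p * (cos (y t))\<^sup>2 + v t * (sin (y t))\<^sup>2) (at t)"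
      using y(3)[of t] t by simp
  qed
  with y(1) have "\<exists>\<theta>. prufer p v a b \<theta> \<and> \<theta> a = c" by blast
  from someI_ex[OF this] show "prufer p v a b (prufer_path p v a b c)" "prufer_path p v a b c a = c"
    by (auto simp: prufer_path_def)
qed

lemma pruferD:
  assumes "prufer p v a b \<theta>"
  shows "continuous_on {a..b} \<theta>"
    and "a < t \<Longrightarrow> t < b \<Longrightarrow> (\<theta> has_real_derivative p * (cos (\<theta> t))\<^sup>2 + v t * (sin (\<theta> t))\<^sup>2) (at t)"
  using assms by (auto simp: prufer_def)

section \<open>Comparison principles for the Pruefer equation\<close>

lemma prufer_supersolution:
  assumes \<theta>: "prufer p v a b \<theta>" and v: "continuous_on {a..b} v"
    and z: "continuous_on {a..b} z" "\<And>t. a < t \<Longrightarrow> t < b \<Longrightarrow> (z has_real_derivative z' t) (at t)"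
    and super: "\<And>t. a < t \<Longrightarrow> t < b \<Longrightarrow> p * (cos (z t))\<^sup>2 + v t * (sin (z t))\<^sup>2 \<le> z' t"
    and init: "\<theta> a \<le> z a" and t: "t \<in> {a..b}"
  shows "\<theta> t \<le> z t"
proof -
  obtain K where K: "\<And>t. t \<in> {a..b} \<Longrightarrow> \<bar>v t - p\<bar> \<le> K"
    using continuous_on_bound_diff[OF v, where p = p] by blast
  show ?thesis
    by (rule ode_comparison[OF pruferD[OF \<theta>] z order_refl super prufer_rhs_Lipschitz[OF K] init t]) auto
qed

lemma prufer_subsolution:
  assumes \<theta>: "prufer p v a b \<theta>" and v: "continuous_on {a..b} v"
    and z: "continuous_on {a..b} z" "\<And>t. a < t \<Longrightarrow> t < b \<Longrightarrow> (z has_real_derivative z' t) (at t)"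
    and sub: "\<And>t. a < t \<Longrightarrow> t < b \<Longrightarrow> z' t \<le> p * (cos (z t))\<^sup>2 + v t * (sin (z t))\<^sup>2"
    and init: "z a \<le> \<theta> a" and t: "t \<in> {a..b}"
  shows "z t \<le> \<theta> t"
proof -
  obtain K where K: "\<And>t. t \<in> {a..b} \<Longrightarrow> \<bar>v t - p\<bar> \<le> K"
    using continuous_on_bound_diff[OF v, where p = p] by blast
  show ?thesis
    by (rule ode_comparison[OF z pruferD[OF \<theta>] sub order_refl prufer_rhs_Lipschitz[OF K] init t]) auto
qed

lemma prufer_subsolution_separation:
  assumes \<theta>: "prufer p v a b \<theta>" and v: "continuous_on {a..b} v"
    and z: "continuous_on {a..b} z" "\<And>t. a < t \<Longrightarrow> t < b \<Longrightarrow> (z has_real_derivative z' t) (at t)"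
    and sub: "\<And>t. a < t \<Longrightarrow> t < b \<Longrightarrow> z' t \<le> p * (cos (z t))\<^sup>2 + v t * (sin (z t))\<^sup>2"
    and init: "z a \<le> \<theta> a" and t: "t \<in> {a..b}" and eq: "z b = \<theta> b"
  shows "z t = \<theta> t"
proof -
  obtain K where K: "\<And>t. t \<in> {a..b} \<Longrightarrow> \<bar>v t - p\<bar> \<le> K"
    using continuous_on_bound_diff[OF v, where p = p] by blast
  show ?thesis
    by (rule ode_separation[OF z pruferD[OF \<theta>] sub order_refl prufer_rhs_Lipschitz[OF K] init t eq]) auto
qed

section \<open>Monotone and continuous dependence of the angle on data and potential\<close>

context
  fixes a b :: real
  assumes ab: "a < b"
begin

lemma prufer_mono:
  assumes "prufer p v a b \<theta>" "prufer p w a b \<eta>" "continuous_on {a..b} v"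
    and "\<And>t. t \<in> {a<..<b} \<Longrightarrow> v t \<le> w t" "\<theta> a \<le> \<eta> a"
  shows "\<theta> b \<le> \<eta> b"
  by (rule prufer_supersolution[OF assms(1,3) pruferD[OF assms(2)]])
    (use assms(4,5) ab in \<open>auto intro!: mult_right_mono\<close>)

text \<open>The lower path is a subsolution of the upper equation. If the end values agreed,
  separation would carry the equality back to the initial values.\<close>

lemma prufer_strict_mono_init:
  assumes "prufer p v a b \<theta>" "prufer p w a b \<eta>" "continuous_on {a..b} w"
    and "\<And>t. t \<in> {a<..<b} \<Longrightarrow> v t \<le> w t" "\<theta> a < \<eta> a"
  shows "\<theta> b < \<eta> b"
proof (rule ccontr)
  have sub: "p * (cos (\<theta> t))\<^sup>2 + v t * (sin (\<theta> t))\<^sup>2 \<le> p * (cos (\<theta> t))\<^sup>2 + w t * (sin (\<theta> t))\<^sup>2"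
    if "a < t" "t < b" for t using assms(4) that by (auto intro!: mult_right_mono)
  assume "\<not> \<theta> b < \<eta> b"
  with prufer_subsolution[OF assms(2,3) pruferD[OF assms(1)] sub, of b] ab assms(5)
  have "\<theta> b = \<eta> b" by auto
  then have "\<theta> a = \<eta> a"
    using prufer_subsolution_separation[OF assms(2,3) pruferD[OF assms(1)] sub, of a] ab assms(5) by auto
  with assms(5) show False by simp
qed

text \<open>Equal end values make the two paths coincide by separation. Subtracting the equations
  then gives \<open>sin (\<theta> t) = 0\<close> throughout, so the derivative of this sine vanishes
  too; as \<open>p > 0\<close>, the cosine would vanish with it. For \<open>p = 0\<close> the
  constant multiples of pi solve the equation for every potential.\<close>

lemma prufer_strict_mono_potential:
  assumes "p > 0" "prufer p v a b \<theta>" "prufer p w a b \<eta>" "continuous_on {a..b} w"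
    and "\<And>t. t \<in> {a<..<b} \<Longrightarrow> v t < w t" "\<theta> a \<le> \<eta> a"
  shows "\<theta> b < \<eta> b"
proof (rule ccontr)
  have sub: "p * (cos (\<theta> t))\<^sup>2 + v t * (sin (\<theta> t))\<^sup>2 \<le> p * (cos (\<theta> t))\<^sup>2 + w t * (sin (\<theta> t))\<^sup>2"
    if "a < t" "t < b" for t using assms(5)[of t] that by (simp add: mult_right_mono)
  assume "\<not> \<theta> b < \<eta> b"
  with prufer_subsolution[OF assms(3,4) pruferD[OF assms(2)] sub, of b] ab assms(6)
  have eqb: "\<theta> b = \<eta> b" by auto
  have eq: "\<theta> t = \<eta> t" if "t \<in> {a..b}" for t
    by (rule prufer_subsolution_separation[OF assms(3,4) pruferD[OF assms(2)] sub assms(6) that eqb])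
  have sin0: "sin (\<theta> t) = 0" if t: "t \<in> {a<..<b}" for t
  proof -
    have "(\<eta> has_real_derivative p * (cos (\<theta> t))\<^sup>2 + v t * (sin (\<theta> t))\<^sup>2) (at t)"
      by (rule has_field_derivative_transform_within_open[OF pruferD(2)[OF assms(2)], of _ "{a<..<b}"])
        (use t eq in auto)
    moreover have "(\<eta> has_real_derivative p * (cos (\<eta> t))\<^sup>2 + w t * (sin (\<eta> t))\<^sup>2) (at t)"
      using pruferD(2)[OF assms(3)] t by auto
    ultimately have "(v t - w t) * (sin (\<theta> t))\<^sup>2 = 0"
      using DERIV_unique eq[of t] t by (fastforce simp: algebra_simps)
    with assms(5)[OF t] show ?thesis by simp
  qed
  define m where "m = (a + b) / 2"
  have m: "m \<in> {a<..<b}" using ab by (auto simp: m_def)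
  have "((\<lambda>t. sin (\<theta> t)) has_real_derivative cos (\<theta> m) * (p * (cos (\<theta> m))\<^sup>2 + v m * (sin (\<theta> m))\<^sup>2)) (at m)"
    by (rule derivative_eq_intros pruferD(2)[OF assms(2)] refl | use m in simp)+
  moreover have "((\<lambda>t. sin (\<theta> t)) has_real_derivative 0) (at m)"
    by (rule has_field_derivative_transform_within_open[of "\<lambda>_. 0" _ _ "{a<..<b}"]) (use m sin0 in auto)
  ultimately have "cos (\<theta> m) * (p * (cos (\<theta> m))\<^sup>2 + v m * (sin (\<theta> m))\<^sup>2) = 0"
    by (rule DERIV_unique)
  with sin0[OF m] \<open>p > 0\<close> have "cos (\<theta> m) = 0" by (auto simp: add_nonneg_eq_0_iff)
  with sin0[OF m] sin_cos_squared_add[of "\<theta> m"] show False by simp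
qed

text \<open>Gronwall estimate obtained by comparison: with the explicit error function
  \<open>h\<close>, the curves \<theta> + h and \<theta> - h are a super- and a subsolution of the
  equation of \<eta>.\<close>

lemma prufer_dist:
  assumes \<theta>: "prufer p v a b \<theta>" and \<eta>: "prufer p w a b \<eta>" and v: "continuous_on {a..b} v"
    and w: "continuous_on {a..b} w" and K: "\<And>t. t \<in> {a<..<b} \<Longrightarrow> \<bar>v t - p\<bar> \<le> K"
    and \<delta>: "\<And>t. t \<in> {a<..<b} \<Longrightarrow> \<bar>w t - v t\<bar> \<le> \<delta>"
  shows "\<bar>\<eta> b - \<theta> b\<bar> \<le> (\<bar>\<eta> a - \<theta> a\<bar> + \<delta> * (b - a)) * exp (K * (b - a))"
proof -
  have K0: "K \<ge> 0" and \<delta>0: "\<delta> \<ge> 0"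
    using K[of "(a + b) / 2"] \<delta>[of "(a + b) / 2"] ab by auto
  \<comment> \<open>Chosen so that its derivative \<open>h'\<close> dominates
    \<open>K * h t + \<delta>\<close>: the first term pays for the Lipschitz error, the second for
    the change of potential.\<close>
  define h where "h t = (\<bar>\<eta> a - \<theta> a\<bar> + \<delta> * (t - a)) * exp (K * (t - a))" for t
  define h' where "h' t = \<delta> * exp (K * (t - a)) + K * h t" for t
  have h0: "h t \<ge> 0" if "t \<ge> a" for t using that \<delta>0 by (simp add: h_def)
  have h: "(h has_real_derivative h' t) (at t)" for t
    unfolding h_def h'_def by (rule derivative_eq_intros refl | simp add: algebra_simps)+
  have hc: "continuous_on {a..b} h" unfolding h_def by (intro continuous_intros)
  have bnd: "\<bar>(p * (cos z)\<^sup>2 + w t * (sin z)\<^sup>2) - (p * (cos y)\<^sup>2 + v t * (sin y)\<^sup>2)\<bar> \<le> h' t"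
    if t: "a < t" "t < b" and zy: "\<bar>z - y\<bar> = h t" for t y z
  proof -
    have "\<bar>(w t - v t) * (sin z)\<^sup>2\<bar> \<le> \<delta> * 1"
      unfolding abs_mult using \<delta>[of t] t \<delta>0 by (intro mult_mono) (auto simp: abs_square_le_1)
    also have "\<dots> \<le> \<delta> * exp (K * (t - a))"
      using t K0 \<delta>0 by (intro mult_left_mono) auto
    finally have "\<bar>(w t - v t) * (sin z)\<^sup>2\<bar> \<le> \<delta> * exp (K * (t - a))" .
    moreover have "\<bar>(p * (cos z)\<^sup>2 + v t * (sin z)\<^sup>2) - (p * (cos y)\<^sup>2 + v t * (sin y)\<^sup>2)\<bar> \<le> K * h t"
      using prufer_rhs_Lipschitz[OF K, of t z y] t zy by simp
    ultimately show ?thesis unfolding h'_def left_diff_distrib by linarith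
  qed
  have "\<eta> b \<le> \<theta> b + h b"
  proof (rule prufer_supersolution[OF \<eta> w, of "\<lambda>t. \<theta> t + h t"])
    fix t assume t: "a < t" "t < b"
    show "((\<lambda>t. \<theta> t + h t) has_real_derivative (p * (cos (\<theta> t))\<^sup>2 + v t * (sin (\<theta> t))\<^sup>2) + h' t) (at t)"
      by (intro derivative_intros h pruferD(2)[OF \<theta>] t)
    show "p * (cos (\<theta> t + h t))\<^sup>2 + w t * (sin (\<theta> t + h t))\<^sup>2
        \<le> (p * (cos (\<theta> t))\<^sup>2 + v t * (sin (\<theta> t))\<^sup>2) + h' t"
      using bnd[OF t, of "\<theta> t + h t" "\<theta> t"] h0[of t] t by auto
  qed (use ab in \<open>auto intro!: continuous_intros hc pruferD(1)[OF \<theta>] simp: h_def\<close>)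
  moreover have "\<theta> b - h b \<le> \<eta> b"
  proof (rule prufer_subsolution[OF \<eta> w, of "\<lambda>t. \<theta> t - h t"])
    fix t assume t: "a < t" "t < b"
    show "((\<lambda>t. \<theta> t - h t) has_real_derivative (p * (cos (\<theta> t))\<^sup>2 + v t * (sin (\<theta> t))\<^sup>2) - h' t) (at t)"
      by (intro derivative_intros h pruferD(2)[OF \<theta>] t)
    show "(p * (cos (\<theta> t))\<^sup>2 + v t * (sin (\<theta> t))\<^sup>2) - h' t
        \<le> p * (cos (\<theta> t - h t))\<^sup>2 + w t * (sin (\<theta> t - h t))\<^sup>2"
      using bnd[OF t, of "\<theta> t - h t" "\<theta> t"] h0[of t] t by auto
  qed (use ab in \<open>auto intro!: continuous_intros hc pruferD(1)[OF \<theta>] simp: h_def\<close>)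
  ultimately show ?thesis unfolding h_def by (simp add: abs_le_iff)
qed

end

text \<open>For fixed \<open>x\<close> the bound \<open>K\<close> depends on the potential at
  \<open>x\<close> alone, so \<open>prufer_dist\<close> estimates the change of the flow by a
  function of \<open>y\<close> that tends to 0 as \<open>y\<close> tends to
  \<open>x\<close>.\<close>

lemma prufer_flow_continuous:
  fixes V :: "real \<Rightarrow> real \<Rightarrow> real"
  assumes ab: "a < b" and c: "continuous_on UNIV c"
    and V: "\<And>x. continuous_on {a..b} (V x)"
    and VL: "\<And>x y t. t \<in> {a..b} \<Longrightarrow> \<bar>V y t - V x t\<bar> \<le> B * \<bar>y - x\<bar>"
  shows "continuous_on UNIV (\<lambda>x. prufer_flow p (V x) a b (c x))"
proof (rule continuous_at_imp_continuous_on, rule ballI)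
  fix x
  let ?F = "\<lambda>x. prufer_flow p (V x) a b (c x)"
  note path = prufer_path[OF less_imp_le[OF ab] V]
  obtain K where K: "\<And>t. t \<in> {a..b} \<Longrightarrow> \<bar>V x t - p\<bar> \<le> K"
    using continuous_on_bound_diff[OF V, where p = p] by blast
  have bound: "norm (?F y - ?F x) \<le> (\<bar>c y - c x\<bar> + B * \<bar>y - x\<bar> * (b - a)) * exp (K * (b - a))" for y
    using prufer_dist[OF ab path(1)[of p x "c x"] path(1)[of p y "c y"] V V K VL] by (simp add: path(2))
  have "((\<lambda>y. (\<bar>c y - c x\<bar> + B * \<bar>y - x\<bar> * (b - a)) * exp (K * (b - a)))
      \<longlongrightarrow> (\<bar>c x - c x\<bar> + B * \<bar>x - x\<bar> * (b - a)) * exp (K * (b - a))) (at x)"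
    using c by (intro tendsto_intros) (auto simp: continuous_on_def)
  then have lim: "((\<lambda>y. (\<bar>c y - c x\<bar> + B * \<bar>y - x\<bar> * (b - a)) * exp (K * (b - a))) \<longlongrightarrow> 0) (at x)"
    by simp
  have "((\<lambda>y. ?F y - ?F x) \<longlongrightarrow> 0) (at x)"
    by (rule Lim_null_comparison[OF always_eventually lim]) (rule allI, rule bound)
  then show "isCont ?F x" by (simp add: isCont_def LIM_zero_iff)
qed

lemma sin_of_int_times_pi [simp]: "sin (of_int k * pi) = 0"
  using sin_npi_int[of k] by (simp add: mult.commute)

section \<open>The linear system behind the Pruefer angle\<close>

text \<open>Polar coordinates read backwards: the amplitude must satisfy \<rho>' = (p - v) sin
  \<theta> cos \<theta> \<rho>, so it is the exponential of an antiderivative and stays positive.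
  The pair (\<rho> sin \<theta>, \<rho> cos \<theta>) then solves the linear system.\<close>

lemma prufer_amplitude:
  assumes \<theta>: "prufer p v a b \<theta>" and v: "continuous_on {a..b} v"
  shows "\<exists>\<rho>. continuous_on {a..b} \<rho> \<and> (\<forall>t. \<rho> t > 0) \<and> \<rho> a = 1 \<and>
    (\<forall>t\<in>{a<..<b}.
       ((\<lambda>t. \<rho> t * sin (\<theta> t)) has_real_derivative p * (\<rho> t * cos (\<theta> t))) (at t) \<and>
       ((\<lambda>t. \<rho> t * cos (\<theta> t)) has_real_derivative - v t * (\<rho> t * sin (\<theta> t))) (at t))"
proof -
  define h where "h t = (p - v t) * sin (\<theta> t) * cos (\<theta> t)" for t
  have "continuous_on {a..b} h"
    unfolding h_def by (intro continuous_intros v pruferD(1)[OF \<theta>])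
  then obtain G where G: "\<And>t. t \<in> {a..b} \<Longrightarrow> (G has_real_derivative h t) (at t within {a..b})"
    by (elim antiderivative_continuous) (auto simp: has_real_derivative_iff_has_vector_derivative)
  have G': "(G has_real_derivative h t) (at t)" if "a < t" "t < b" for t
    using G[of t] that by (metis at_within_Icc_at atLeastAtMost_iff less_imp_le)
  define \<rho> where "\<rho> t = exp (G t - G a)" for t
  have \<rho>': "(\<rho> has_real_derivative h t * \<rho> t) (at t)" if "a < t" "t < b" for t
    unfolding \<rho>_def by (auto intro!: derivative_eq_intros G' that)
  have cs: "(cos x)\<^sup>2 = 1 - (sin x)\<^sup>2" for x :: real by (simp add: cos_squared_eq)
  show ?thesis
  proof (intro exI[of _ \<rho>] conjI ballI)
    show "continuous_on {a..b} \<rho>"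
      unfolding \<rho>_def by (intro continuous_intros DERIV_continuous_on[OF G])
    fix t assume "t \<in> {a<..<b}"
    then have t: "a < t" "t < b" by auto
    let ?s = "sin (\<theta> t)" and ?c = "cos (\<theta> t)"
    have "((\<lambda>t. \<rho> t * sin (\<theta> t)) has_real_derivative
        h t * \<rho> t * ?s + (?c * (p * ?c\<^sup>2 + v t * ?s\<^sup>2)) * \<rho> t) (at t)"
      by (intro DERIV_mult \<rho>' t DERIV_fun_sin pruferD(2)[OF \<theta>])
    also have "h t * \<rho> t * ?s + (?c * (p * ?c\<^sup>2 + v t * ?s\<^sup>2)) * \<rho> t = p * (\<rho> t * ?c)"
      unfolding h_def cs by (simp add: power2_eq_square algebra_simps)
    finally show "((\<lambda>t. \<rho> t * sin (\<theta> t)) has_real_derivative p * (\<rho> t * ?c)) (at t)" .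
    have "((\<lambda>t. \<rho> t * cos (\<theta> t)) has_real_derivative
        h t * \<rho> t * ?c + (- ?s * (p * ?c\<^sup>2 + v t * ?s\<^sup>2)) * \<rho> t) (at t)"
      by (intro DERIV_mult \<rho>' t DERIV_fun_cos pruferD(2)[OF \<theta>])
    also have "h t * \<rho> t * ?c + (- ?s * (p * ?c\<^sup>2 + v t * ?s\<^sup>2)) * \<rho> t
        = (p - v t) * \<rho> t * ?s * ?c\<^sup>2 - ?s * (p * ?c\<^sup>2 + v t * ?s\<^sup>2) * \<rho> t"
      unfolding h_def by (simp add: power2_eq_square algebra_simps)
    also have "\<dots> = - v t * (\<rho> t * ?s)"
      unfolding cs by (simp add: power2_eq_square algebra_simps)
    finally show "((\<lambda>t. \<rho> t * cos (\<theta> t)) has_real_derivative - v t * (\<rho> t * ?s)) (at t)" .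
  qed (auto simp: \<rho>_def)
qed

text \<open>The energy \<open>E\<close> satisfies \<open>E' s \<le> K * E s\<close> and vanishes at
  \<open>a\<close>, so Gronwall keeps it at 0. Values in an inner product space cover complex
  eigenfunctions.\<close>

lemma linear_system_unique:
  fixes \<phi> \<psi> :: "real \<Rightarrow> 'a :: real_inner" and p :: real
  assumes v: "continuous_on {a..b} v"
    and \<phi>: "continuous_on {a..b} \<phi>"
      "\<And>t. a < t \<Longrightarrow> t < b \<Longrightarrow> (\<phi> has_vector_derivative p *\<^sub>R \<psi> t) (at t)"
    and \<psi>: "continuous_on {a..b} \<psi>"
      "\<And>t. a < t \<Longrightarrow> t < b \<Longrightarrow> (\<psi> has_vector_derivative (- v t) *\<^sub>R \<phi> t) (at t)"
    and init: "\<phi> a = 0" "\<psi> a = 0" and t: "t \<in> {a..b}"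
  shows "\<phi> t = 0" and "\<psi> t = 0"
proof -
  obtain K where K: "K > 0" "\<And>t. t \<in> {a..b} \<Longrightarrow> \<bar>v t - p\<bar> \<le> K"
    using continuous_on_bound_diff[OF v, where p = p] by blast
  define E where "E t = \<phi> t \<bullet> \<phi> t + \<psi> t \<bullet> \<psi> t" for t
  define E' where "E' t = 2 * (p - v t) * (\<phi> t \<bullet> \<psi> t)" for t
  have der: "(E has_real_derivative E' s) (at s)" if "a < s" "s < b" for s
  proof -
    note inner = bounded_bilinear.has_vector_derivative[OF bounded_bilinear_inner]
    have "(E has_vector_derivative (\<phi> s \<bullet> (p *\<^sub>R \<psi> s) + (p *\<^sub>R \<psi> s) \<bullet> \<phi> s) +
        (\<psi> s \<bullet> ((- v s) *\<^sub>R \<phi> s) + ((- v s) *\<^sub>R \<phi> s) \<bullet> \<psi> s)) (at s)"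
      unfolding E_def by (intro has_vector_derivative_add inner \<phi>(2) \<psi>(2) that)
    then show ?thesis
      by (simp add: has_real_derivative_iff_has_vector_derivative E'_def inner_commute algebra_simps)
  qed
  have bound: "E' s \<le> K * E s" if "a < s" "s < b" for s
  proof -
    have "0 \<le> (\<phi> s - \<psi> s) \<bullet> (\<phi> s - \<psi> s)" "0 \<le> (\<phi> s + \<psi> s) \<bullet> (\<phi> s + \<psi> s)" by simp_all
    then have "\<bar>2 * (\<phi> s \<bullet> \<psi> s)\<bar> \<le> E s"
      by (simp add: E_def inner_diff inner_add inner_commute)
    then have "\<bar>p - v s\<bar> * \<bar>2 * (\<phi> s \<bullet> \<psi> s)\<bar> \<le> K * E s"
      using K(2)[of s] that K(1) by (intro mult_mono) auto
    moreover have "E' s \<le> \<bar>p - v s\<bar> * \<bar>2 * (\<phi> s \<bullet> \<psi> s)\<bar>"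
      unfolding E'_def by (subst abs_mult[symmetric]) (simp add: algebra_simps)
    ultimately show ?thesis by simp
  qed
  have "- (E a * exp (- K * a)) \<le> - (E t * exp (- K * t))"
  proof (rule nondecreasing_if_deriv_nonneg_interior[where f = "\<lambda>t. - (E t * exp (- K * t))"
        and f' = "\<lambda>t. (K * E t - E' t) * exp (- K * t)"])
    show "continuous_on {a..t} (\<lambda>t. - (E t * exp (- K * t)))"
      unfolding E_def
      by (intro continuous_intros continuous_on_subset[OF \<phi>(1)] continuous_on_subset[OF \<psi>(1)])
        (use t in auto)
    fix s assume s: "a < s" "s < t"
    then show "((\<lambda>t. - (E t * exp (- K * t))) has_real_derivative (K * E s - E' s) * exp (- K * s)) (at s)"
      using t by (auto intro!: derivative_eq_intros der simp: algebra_simps)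
    show "0 \<le> (K * E s - E' s) * exp (- K * s)" using bound[of s] s t by auto
  qed (use t in auto)
  then have "E t * exp (- K * t) \<le> 0" by (simp add: E_def init)
  then have "E t \<le> 0" by (simp add: mult_le_0_iff not_le)
  then have "\<phi> t \<bullet> \<phi> t = 0 \<and> \<psi> t \<bullet> \<psi> t = 0"
    unfolding E_def by (smt (verit) inner_ge_zero)
  then show "\<phi> t = 0" "\<psi> t = 0" by simp_all
qed

text \<open>For \<open>p = 0\<close> the linear system keeps the first component constant and lowers
  the second by \<sigma> times the first in unit time. With \<sigma> = M \<mu> this is the jump
  condition at a mass.\<close>

lemma prufer_mass:
  assumes \<theta>: "prufer 0 (\<lambda>_. \<sigma>) 0 1 \<theta>"
  obtains r where "r > 0" "r * sin (\<theta> 1) = sin (\<theta> 0)" "r * cos (\<theta> 1) = cos (\<theta> 0) - \<sigma> * sin (\<theta> 0)"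
proof -
  obtain \<rho> where \<rho>: "continuous_on {0..1} \<rho>" "\<forall>t. \<rho> t > 0" "\<rho> 0 = 1"
    and \<rho>': "\<forall>t\<in>{0<..<1}.
       ((\<lambda>t. \<rho> t * sin (\<theta> t)) has_real_derivative 0 * (\<rho> t * cos (\<theta> t))) (at t) \<and>
       ((\<lambda>t. \<rho> t * cos (\<theta> t)) has_real_derivative - \<sigma> * (\<rho> t * sin (\<theta> t))) (at t)"
    using prufer_amplitude[OF \<theta> continuous_on_const] by blast
  note cont = \<rho>(1) pruferD(1)[OF \<theta>]
  have conts: "continuous_on {0..1} (\<lambda>t. \<rho> t * sin (\<theta> t))" by (intro continuous_intros cont)
  have const: "\<rho> t * sin (\<theta> t) = sin (\<theta> 0)" if "0 \<le> t" "t \<le> 1" for t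
    using DERIV_isconst2[OF zero_less_one conts, of t] \<rho>(3) \<rho>' that by auto
  have "\<rho> 1 * cos (\<theta> 1) + \<sigma> * sin (\<theta> 0) * 1 = \<rho> 0 * cos (\<theta> 0) + \<sigma> * sin (\<theta> 0) * 0"
  proof (rule DERIV_isconst_end[of 0 1 "\<lambda>t. \<rho> t * cos (\<theta> t) + \<sigma> * sin (\<theta> 0) * t"])
    fix t :: real assume t: "0 < t" "t < 1"
    show "((\<lambda>t. \<rho> t * cos (\<theta> t) + \<sigma> * sin (\<theta> 0) * t) has_real_derivative 0) (at t)"
    proof -
      have "((\<lambda>t. \<rho> t * cos (\<theta> t)) has_real_derivative - \<sigma> * (\<rho> t * sin (\<theta> t))) (at t)"
        using \<rho>' t by auto
      from DERIV_add[OF this DERIV_cmult_Id[of "\<sigma> * sin (\<theta> 0)"]] const[of t] t show ?thesis by simp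
    qed
  qed (auto intro!: continuous_intros cont)
  with const[of 1] \<rho>(2,3) that[of "\<rho> 1"] show ?thesis by simp
qed

section \<open>Multiples of pi as barriers for the angle\<close>

text \<open>At a multiple of pi the right-hand side equals \<open>p\<close>, so a nonnegative
  \<open>p\<close> makes that constant a subsolution.\<close>

lemma prufer_ge_npi:
  assumes ab: "a < b" and \<theta>: "prufer p v a b \<theta>" and v: "continuous_on {a..b} v" and "p \<ge> 0"
    and init: "of_int k * pi \<le> \<theta> a" and t: "t \<in> {a..b}"
  shows "of_int k * pi \<le> \<theta> t"
proof (rule prufer_subsolution[OF \<theta> v, of "\<lambda>_. of_int k * pi" "\<lambda>_. 0"])
  show "0 \<le> p * (cos (of_int k * pi))\<^sup>2 + v t * (sin (of_int k * pi))\<^sup>2" for t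
    using \<open>p \<ge> 0\<close> by simp
qed (use init t in auto)

text \<open>Equality at \<open>b\<close> would make \<theta> constant by separation; its zero
  derivative at the midpoint contradicts the value \<open>p > 0\<close> of the right-hand side
  there.\<close>

lemma prufer_gt_npi:
  assumes ab: "a < b" and \<theta>: "prufer p v a b \<theta>" and v: "continuous_on {a..b} v" and "p > 0"
    and init: "of_int k * pi \<le> \<theta> a"
  shows "of_int k * pi < \<theta> b"
proof (rule ccontr)
  assume "\<not> of_int k * pi < \<theta> b"
  with prufer_ge_npi[OF ab \<theta> v _ init, of b] ab \<open>p > 0\<close> have eqb: "of_int k * pi = \<theta> b" by auto
  have sub: "0 \<le> p * (cos (of_int k * pi))\<^sup>2 + v t * (sin (of_int k * pi))\<^sup>2" for t
    using \<open>p > 0\<close> by simp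
  have eq: "of_int k * pi = \<theta> t" if "t \<in> {a..b}" for t
    by (rule prufer_subsolution_separation[OF \<theta> v, of "\<lambda>_. of_int k * pi" "\<lambda>_. 0", OF _ _ sub init that eqb])
      auto
  define m where "m = (a + b) / 2"
  have m: "a < m" "m < b" using ab by (auto simp: m_def)
  have "(\<theta> has_real_derivative 0) (at m)"
    by (rule has_field_derivative_transform_within_open[of "\<lambda>_. of_int k * pi" _ _ "{a<..<b}"])
      (use m eq in auto)
  with pruferD(2)[OF \<theta> m] have "p * (cos (\<theta> m))\<^sup>2 + v m * (sin (\<theta> m))\<^sup>2 = 0"
    by (rule DERIV_unique[OF _ _, symmetric, rotated]) 
  moreover have "sin (\<theta> m) = 0" using eq[of m] m by (metis atLeastAtMost_iff less_imp_le sin_of_int_times_pi)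
  ultimately show False
    using \<open>p > 0\<close> sin_cos_squared_add[of "\<theta> m"] by auto
qed

text \<open>For \<open>p = 0\<close> the multiples of pi are themselves solutions, and distinct
  solutions do not meet. A mass therefore never moves the angle across a multiple of pi.\<close>

lemma prufer_mass_between:
  assumes \<theta>: "prufer 0 (\<lambda>_. \<sigma>) 0 1 \<theta>" and "of_int k * pi < \<theta> 0" "\<theta> 0 < of_int (k + 1) * pi"
  shows "of_int k * pi < \<theta> 1" and "\<theta> 1 < of_int (k + 1) * pi"
proof -
  have const: "prufer 0 (\<lambda>_. \<sigma>) 0 1 (\<lambda>_. of_int j * pi)" for j
    by (simp add: prufer_def)
  show "of_int k * pi < \<theta> 1"
    using prufer_strict_mono_init[OF _ const[of k] \<theta>] assms(2) by simp
  show "\<theta> 1 < of_int (k + 1) * pi"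
    using prufer_strict_mono_init[OF _ \<theta> const[of "k + 1"]] assms(3) by simp
qed

lemma prufer_mass_gt_npi:
  assumes \<theta>: "prufer 0 (\<lambda>_. \<sigma>) 0 1 \<theta>" and "of_int k * pi < \<theta> 0"
  shows "of_int k * pi < \<theta> 1"
proof -
  have const: "prufer 0 (\<lambda>_. \<sigma>) 0 1 (\<lambda>_. of_int k * pi)"
    by (simp add: prufer_def)
  show ?thesis
    using prufer_strict_mono_init[OF _ const \<theta>] assms(2) by auto
qed

section \<open>The rescaled angle\<close>

text \<open>
  With \<open>tan \<eta> = R * tan \<theta>\<close>, the angle \<open>\<eta> = rescaled_angle R \<theta>\<close> is the argument of
  \<open>(\<phi>', R * \<phi>)\<close>; this form of the correspondence is smooth on the whole line and fixes the multiples of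
  \<open>pi\<close>.
\<close>

definition rescaled_angle :: "real \<Rightarrow> real \<Rightarrow> real" where
  "rescaled_angle R x = x + arctan ((R - 1) * sin x * cos x / ((cos x)\<^sup>2 + R * (sin x)\<^sup>2))"

lemma sin_cos_form_pos:
  fixes x R :: real
  assumes "R > 0"
  shows "(cos x)\<^sup>2 + R * (sin x)\<^sup>2 > 0"
proof (cases "sin x = 0")
  case True
  then show ?thesis using sin_cos_squared_add[of x] by simp
next
  case False
  then have "R * (sin x)\<^sup>2 > 0" using assms by simp
  then show ?thesis by (smt (verit) zero_le_power2)
qed

lemma rescaled_angle_deriv:
  assumes R: "R > 0"
  shows "(rescaled_angle R has_real_derivative R / ((cos x)\<^sup>2 + R\<^sup>2 * (sin x)\<^sup>2)) (at x)"
proof -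
  let ?s = "sin x" and ?c = "cos x"
  \<comment> \<open>\<open>D\<close> and \<open>N\<close> are the components of the vector (cos x, R
    sin x) along and across the direction with angle \<open>x\<close>, so
    \<open>D\<^sup>2 + N\<^sup>2\<close> is its squared length.\<close>
  define N D where "N = (R - 1) * ?s * ?c" and "D = ?c\<^sup>2 + R * ?s\<^sup>2"
  have D: "D > 0" unfolding D_def by (rule sin_cos_form_pos[OF R])
  have E: "?c\<^sup>2 + R\<^sup>2 * ?s\<^sup>2 > 0" using sin_cos_form_pos[of "R\<^sup>2" x] R by simp
  have c2: "?c\<^sup>2 = 1 - ?s\<^sup>2" by (simp add: cos_squared_eq)
  have "N\<^sup>2 = (R - 1)\<^sup>2 * ?s\<^sup>2 * ?c\<^sup>2" by (simp add: N_def power_mult_distrib)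
  then have ND: "D\<^sup>2 + N\<^sup>2 = ?c\<^sup>2 + R\<^sup>2 * ?s\<^sup>2"
    unfolding D_def c2 by (simp add: power2_eq_square algebra_simps)
  define N' where "N' = (R - 1) * (?c\<^sup>2 - ?s\<^sup>2)"
  define D' where "D' = 2 * (R - 1) * ?s * ?c"
  have 1: "((\<lambda>x. (R - 1) * sin x * cos x) has_real_derivative N') (at x)"
    unfolding N'_def by (auto intro!: derivative_eq_intros simp: power2_eq_square algebra_simps)
  have 2: "((\<lambda>x. (cos x)\<^sup>2 + R * (sin x)\<^sup>2) has_real_derivative D') (at x)"
    unfolding D'_def by (auto intro!: derivative_eq_intros simp: algebra_simps)
  have "((\<lambda>x. (R - 1) * sin x * cos x / ((cos x)\<^sup>2 + R * (sin x)\<^sup>2)) has_real_derivative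
      (N' * D - N * D') / (D * D)) (at x)"
    using DERIV_divide[OF 1 2] D unfolding N_def D_def by auto
  from DERIV_chain2[OF DERIV_arctan this]
  have "(rescaled_angle R has_real_derivative 1 + inverse (1 + (N / D)\<^sup>2) * ((N' * D - N * D') / (D * D))) (at x)"
    unfolding rescaled_angle_def[abs_def] N_def[symmetric] D_def[symmetric]
    by (intro DERIV_add DERIV_ident) 
  moreover have "1 + inverse (1 + (N / D)\<^sup>2) * ((N' * D - N * D') / (D * D))
      = R / (?c\<^sup>2 + R\<^sup>2 * ?s\<^sup>2)"
  proof -
    define E where "E = ?c\<^sup>2 + R\<^sup>2 * ?s\<^sup>2"
    define X where "X = N' * D - N * D'"
    have W: "1 + (N / D)\<^sup>2 = E / D\<^sup>2"
      unfolding E_def ND[symmetric] using D by (simp add: field_simps)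
    have "1 + inverse (1 + (N / D)\<^sup>2) * (X / (D * D)) = 1 + X / E"
      unfolding W using D by (simp add: power2_eq_square)
    also have "\<dots> = (E + X) / E"
      using E unfolding E_def[symmetric] by (simp add: add_divide_distrib)
    also have "E + X = R"
    proof -
      have "N * D' = 2 * (R - 1)\<^sup>2 * ?s\<^sup>2 * ?c\<^sup>2"
        by (simp add: N_def D'_def power2_eq_square algebra_simps)
      then show ?thesis unfolding E_def X_def N'_def D_def c2 by (simp add: power2_eq_square algebra_simps)
    qed
    finally show ?thesis unfolding E_def X_def .
  qed
  ultimately show ?thesis by simp
qed

lemma rescaled_angle_strict_mono:
  assumes "R > 0" "x < y"
  shows "rescaled_angle R x < rescaled_angle R y"
proof (rule DERIV_pos_imp_increasing[OF assms(2)])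
  fix x
  have "R / ((cos x)\<^sup>2 + R\<^sup>2 * (sin x)\<^sup>2) > 0"
    using sin_cos_form_pos[of "R\<^sup>2" x] assms(1) by simp
  then show "\<exists>d. (rescaled_angle R has_real_derivative d) (at x) \<and> d > 0"
    using rescaled_angle_deriv[OF assms(1)] by blast
qed

lemma rescaled_angle_less_iff: "R > 0 \<Longrightarrow> rescaled_angle R x < rescaled_angle R y \<longleftrightarrow> x < y"
  by (metis linorder_less_linear order_less_asym rescaled_angle_strict_mono)

lemma rescaled_angle_npi [simp]: "rescaled_angle R (of_int k * pi) = of_int k * pi"
  by (simp add: rescaled_angle_def)

lemma rescaled_angle_npi_less:
  assumes "R > 0"
  shows "of_int k * pi < rescaled_angle R x \<longleftrightarrow> of_int k * pi < x"
    and "rescaled_angle R x < of_int k * pi \<longleftrightarrow> x < of_int k * pi"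
  using rescaled_angle_less_iff[OF assms, of "of_int k * pi" x]
    rescaled_angle_less_iff[OF assms, of x "of_int k * pi"] by (simp_all only: rescaled_angle_npi)

text \<open>The relation \<open>tan \<eta> = R * tan \<theta>\<close> without division and with the
  quadrant fixed; \<open>r\<close> is the length of the vector (cos x, R sin x).\<close>

lemma rescaled_angle_sin_cos:
  assumes R: "R > 0"
  obtains r where "r > 0" "r * sin (rescaled_angle R x) = R * sin x" "r * cos (rescaled_angle R x) = cos x"
proof -
  let ?s = "sin x" and ?c = "cos x"
  define N D where "N = (R - 1) * ?s * ?c" and "D = ?c\<^sup>2 + R * ?s\<^sup>2"
  have D: "D > 0" unfolding D_def by (rule sin_cos_form_pos[OF R])
  define w where "w = sqrt (1 + (N / D)\<^sup>2)"
  have w: "w > 0" unfolding w_def by (simp add: add_pos_nonneg)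
  have c2: "?c\<^sup>2 = 1 - ?s\<^sup>2" by (simp add: cos_squared_eq)
  have sw: "w * sin (arctan (N / D)) = N / D" and cw: "w * cos (arctan (N / D)) = 1"
    using w by (simp_all add: w_def sin_arctan cos_arctan)
  have "(w * D) * sin (rescaled_angle R x) = D * (?s * (w * cos (arctan (N / D))) + ?c * (w * sin (arctan (N / D))))"
    unfolding rescaled_angle_def N_def[symmetric] D_def[symmetric] by (simp add: sin_add algebra_simps)
  also have "\<dots> = ?s * D + ?c * N" unfolding sw cw using D by (simp add: field_simps)
  also have "\<dots> = R * ?s"
  proof -
    have "?c * N = (R - 1) * ?s * ?c\<^sup>2" by (simp add: N_def power2_eq_square)
    then show ?thesis unfolding D_def c2 by (simp add: power2_eq_square algebra_simps)
  qed
  finally have 1: "(w * D) * sin (rescaled_angle R x) = R * ?s" .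
  have "(w * D) * cos (rescaled_angle R x) = D * (?c * (w * cos (arctan (N / D))) - ?s * (w * sin (arctan (N / D))))"
    unfolding rescaled_angle_def N_def[symmetric] D_def[symmetric] by (simp add: cos_add algebra_simps)
  also have "\<dots> = ?c * D - ?s * N" unfolding sw cw using D by (simp add: field_simps)
  also have "\<dots> = ?c * ?c\<^sup>2 + ?c * ?s\<^sup>2"
    unfolding D_def N_def by (simp add: power2_eq_square algebra_simps)
  also have "\<dots> = ?c" by (simp add: c2 algebra_simps)
  finally have 2: "(w * D) * cos (rescaled_angle R x) = ?c" by simp
  show ?thesis by (rule that[OF _ 1 2]) (use w D in simp)
qed

text \<open>In the rescaled angle the speed is R minus g R sin^2 \<theta> / E with E = cos^2
  \<theta> + R^2 sin^2 \<theta>, and R sin^2 \<theta> / E is at most 1 / R. So \<eta> runs between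
  lines of slopes \<open>R - Q / R\<close> and \<open>R + Q / R\<close>.\<close>

lemma rescaled_angle_string:
  assumes ab: "a \<le> b" and R: "R > 0" and \<theta>: "prufer 1 (\<lambda>t. R\<^sup>2 - g t) a b \<theta>"
    and g: "\<And>t. t \<in> {a<..<b} \<Longrightarrow> \<bar>g t\<bar> \<le> Q"
  shows "\<bar>rescaled_angle R (\<theta> b) - rescaled_angle R (\<theta> a) - R * (b - a)\<bar> \<le> Q / R * (b - a)"
proof -
  define \<eta> where "\<eta> t = rescaled_angle R (\<theta> t)" for t
  define \<eta>' where "\<eta>' t = R / ((cos (\<theta> t))\<^sup>2 + R\<^sup>2 * (sin (\<theta> t))\<^sup>2) *
      (1 * (cos (\<theta> t))\<^sup>2 + (R\<^sup>2 - g t) * (sin (\<theta> t))\<^sup>2)" for t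
  have der: "(\<eta> has_real_derivative \<eta>' t) (at t)" if "a < t" "t < b" for t
    unfolding \<eta>_def \<eta>'_def by (rule DERIV_chain2[OF rescaled_angle_deriv[OF R] pruferD(2)[OF \<theta> that]])
  have cont: "continuous_on {a..b} \<eta>"
    unfolding \<eta>_def
    by (rule continuous_on_compose2[OF DERIV_continuous_on[OF has_field_derivative_at_within[OF rescaled_angle_deriv[OF R]]]
          pruferD(1)[OF \<theta>], of UNIV]) auto
  have bound: "\<bar>\<eta>' t - R\<bar> \<le> Q / R" if t: "a < t" "t < b" for t
  proof -
    let ?s2 = "(sin (\<theta> t))\<^sup>2"
    define E where "E = (cos (\<theta> t))\<^sup>2 + R\<^sup>2 * ?s2"
    have E: "E > 0" using sin_cos_form_pos[of "R\<^sup>2" "\<theta> t"] R by (simp add: E_def)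
    have le: "R\<^sup>2 * ?s2 \<le> E" by (simp add: E_def)
    have "\<eta>' t = R / E * (E - g t * ?s2)" by (simp add: \<eta>'_def E_def algebra_simps)
    then have "\<eta>' t - R = - (R * ?s2 / E) * g t" using E by (simp add: field_simps)
    then have "\<bar>\<eta>' t - R\<bar> = R * ?s2 / E * \<bar>g t\<bar>" using E R by (simp add: abs_mult)
    also have "\<dots> \<le> 1 / R * Q"
    proof (rule mult_mono)
      show "R * ?s2 / E \<le> 1 / R" using le E R by (simp add: field_simps power2_eq_square)
    qed (use g t R in auto)
    finally show ?thesis by simp
  qed
  have "\<eta> a - (R - Q / R) * a \<le> \<eta> b - (R - Q / R) * b"
    by (rule nondecreasing_if_deriv_nonneg_interior[where f = "\<lambda>t. \<eta> t - (R - Q / R) * t"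
          and f' = "\<lambda>t. \<eta>' t - (R - Q / R)", OF ab])
      (use bound in \<open>force intro!: continuous_intros cont derivative_eq_intros der simp: abs_le_iff\<close>)+
  moreover have "(R + Q / R) * a - \<eta> a \<le> (R + Q / R) * b - \<eta> b"
    by (rule nondecreasing_if_deriv_nonneg_interior[where f = "\<lambda>t. (R + Q / R) * t - \<eta> t"
          and f' = "\<lambda>t. (R + Q / R) - \<eta>' t", OF ab])
      (use bound in \<open>force intro!: continuous_intros cont derivative_eq_intros der simp: abs_le_iff\<close>)+
  moreover define u where "u = Q / R"
  ultimately have "\<bar>\<eta> b - \<eta> a - R * (b - a)\<bar> \<le> u * (b - a)"
    unfolding u_def[symmetric] by (simp add: abs_le_iff algebra_simps)
  then show ?thesis by (simp add: \<eta>_def u_def)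
qed

section \<open>Effect of a mass on the rescaled angle\<close>

text \<open>The difference \<open>sin x - x / 2\<close> increases up to \<open>pi / 3\<close> and
  decreases afterwards; it is 0 at 0 and 1 - pi / 4 > 0 at \<open>pi / 2\<close>.\<close>

lemma sin_ge_half:
  fixes x :: real
  assumes "0 \<le> x" "x \<le> pi / 2"
  shows "x / 2 \<le> sin x"
proof (cases "x \<le> pi / 3")
  case True
  have "sin 0 - 0 / 2 \<le> sin x - x / 2"
  proof (rule nondecreasing_if_deriv_nonneg_interior[where f = "\<lambda>x. sin x - x / 2" and f' = "\<lambda>x. cos x - 1 / 2"])
    fix t assume "0 < t" "t < x"
    then have "cos (pi / 3) \<le> cos t" using True by (intro cos_monotone_0_pi_le) auto
    then show "0 \<le> cos t - 1 / 2" by (simp add: cos_60)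
  qed (auto intro!: continuous_intros derivative_eq_intros assms(1))
  then show ?thesis by simp
next
  case False
  have "- (sin x - x / 2) \<le> - (sin (pi / 2) - pi / 2 / 2)"
  proof (rule nondecreasing_if_deriv_nonneg_interior[where f = "\<lambda>x. - (sin x - x / 2)" and f' = "\<lambda>x. 1 / 2 - cos x"])
    fix t assume "x < t" "t < pi / 2"
    then have "cos t \<le> cos (pi / 3)" using False by (intro cos_monotone_0_pi_le) auto
    then show "0 \<le> 1 / 2 - cos t" by (simp add: cos_60)
  qed (use assms(2) in \<open>auto intro!: continuous_intros derivative_eq_intros\<close>)
  then show ?thesis using pi_less_4 by simp
qed

text \<open>Let x be the height of the rescaled angle above k pi before the mass and y its depth
  below (k + 1) pi after it. The jump condition reads cot y = M R - cot x. The distance c / R from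
  the multiples of pi keeps cot x below M R / 2, hence cot y \<ge> M R / 2 and y \<le> 4 / (M R)
  \<le> c / R.\<close>

lemma rescaled_angle_mass:
  assumes M: "M > 0" and R: "R > 0" and \<theta>: "prufer 0 (\<lambda>_. M * R\<^sup>2) 0 1 \<theta>"
    and lower: "of_int k * pi + c / R \<le> rescaled_angle R (\<theta> 0)"
    and upper: "rescaled_angle R (\<theta> 0) \<le> of_int (k + 1) * pi - c / R"
    and c: "4 / M \<le> c"
  shows "of_int (k + 1) * pi - c / R \<le> rescaled_angle R (\<theta> 1)"
    and "rescaled_angle R (\<theta> 1) \<le> of_int (k + 1) * pi"
proof -
  have c0: "c > 0" using c M by (smt (verit) divide_pos_pos)
  then have cR: "c / R > 0" using R by simp
  have "of_int k * pi < \<theta> 0" "\<theta> 0 < of_int (k + 1) * pi"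
    using lower upper cR rescaled_angle_npi_less(1)[OF R, of k "\<theta> 0"]
      rescaled_angle_npi_less(2)[OF R, of "\<theta> 0" "k + 1"] by linarith+
  from prufer_mass_between[OF \<theta> this]
  have th1: "of_int k * pi < rescaled_angle R (\<theta> 1)" "rescaled_angle R (\<theta> 1) < of_int (k + 1) * pi"
    by (simp_all only: rescaled_angle_npi_less[OF R])
  then show "rescaled_angle R (\<theta> 1) \<le> of_int (k + 1) * pi" by simp
  define x where "x = rescaled_angle R (\<theta> 0) - of_int k * pi"
  define y where "y = of_int (k + 1) * pi - rescaled_angle R (\<theta> 1)"
  have x: "c / R \<le> x" "x \<le> pi - c / R" using lower upper by (auto simp: x_def algebra_simps)
  have y: "0 < y" "y < pi" using th1 by (auto simp: y_def algebra_simps)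
  obtain r0 where r0: "r0 > 0" "r0 * sin (rescaled_angle R (\<theta> 0)) = R * sin (\<theta> 0)"
    "r0 * cos (rescaled_angle R (\<theta> 0)) = cos (\<theta> 0)" by (rule rescaled_angle_sin_cos[OF R])
  obtain r1 where r1: "r1 > 0" "r1 * sin (rescaled_angle R (\<theta> 1)) = R * sin (\<theta> 1)"
    "r1 * cos (rescaled_angle R (\<theta> 1)) = cos (\<theta> 1)" by (rule rescaled_angle_sin_cos[OF R])
  obtain r where r: "r > 0" "r * sin (\<theta> 1) = sin (\<theta> 0)"
    "r * cos (\<theta> 1) = cos (\<theta> 0) - M * R\<^sup>2 * sin (\<theta> 0)" by (rule prufer_mass[OF \<theta>])
  \<comment> \<open>The sign (-1)^k produced by shifting both angles by k pi; it is removed through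
    \<open>\<epsilon> * \<epsilon> = 1\<close>.\<close>
  define \<epsilon> :: real where "\<epsilon> = cos (of_int k * pi)"
  have sk: "sin (of_int k * pi) = 0" by (rule sin_of_int_times_pi)
  have \<epsilon>: "\<epsilon> * \<epsilon> = 1" using sin_cos_squared_add[of "of_int k * pi"] sk by (simp add: \<epsilon>_def power2_eq_square)
  have t0: "rescaled_angle R (\<theta> 0) = x + of_int k * pi" by (simp add: x_def)
  have t1: "rescaled_angle R (\<theta> 1) = of_int k * pi + (pi - y)" by (simp add: y_def algebra_simps)
  have s0: "r0 * (\<epsilon> * sin x) = R * sin (\<theta> 0)" "r0 * (\<epsilon> * cos x) = cos (\<theta> 0)"
    using r0(2,3) unfolding t0 sin_add cos_add sk \<epsilon>_def by (simp_all add: mult_ac)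
  have s1: "r1 * (\<epsilon> * sin y) = R * sin (\<theta> 1)" "- (r1 * (\<epsilon> * cos y)) = cos (\<theta> 1)"
    using r1(2,3) unfolding t1 sin_add cos_add sk \<epsilon>_def by simp_all
  \<comment> \<open>\<open>e1\<close> is the continuity of the solution at the mass and
    \<open>e2\<close> the jump of its derivative; their quotient is cot y = M R - cot x.\<close>
  have e1: "r * r1 * sin y = r0 * sin x"
  proof -
    have "\<epsilon> * (r * (r1 * (\<epsilon> * sin y))) = \<epsilon> * (R * sin (\<theta> 0))"
      unfolding s1 r(2)[symmetric] by simp
    also have "\<dots> = \<epsilon> * (r0 * (\<epsilon> * sin x))" by (simp add: s0)
    finally have "(\<epsilon> * \<epsilon>) * (r * r1 * sin y) = (\<epsilon> * \<epsilon>) * (r0 * sin x)" by (simp add: mult_ac)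
    then show ?thesis by (simp add: \<epsilon>)
  qed
  have e2: "r * r1 * cos y = r0 * (M * R * sin x - cos x)"
  proof -
    have "\<epsilon> * (r * (r1 * (\<epsilon> * cos y))) = - (\<epsilon> * (r * cos (\<theta> 1)))"
      unfolding s1(2)[symmetric] by simp
    also have "\<dots> = \<epsilon> * (M * R * (R * sin (\<theta> 0)) - cos (\<theta> 0))"
      unfolding r(3) by (simp add: power2_eq_square algebra_simps)
    also have "\<dots> = \<epsilon> * (M * R * (r0 * (\<epsilon> * sin x)) - r0 * (\<epsilon> * cos x))" by (simp add: s0)
    finally have "(\<epsilon> * \<epsilon>) * (r * r1 * cos y) = (\<epsilon> * \<epsilon>) * (r0 * (M * R * sin x - cos x))"
      by (simp add: algebra_simps)
    then show ?thesis by (simp add: \<epsilon>)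
  qed
  have sinx: "sin x \<ge> c / R / 2"
  proof (cases "x \<le> pi / 2")
    case True
    then show ?thesis using sin_ge_half[of x] x cR by auto
  next
    case False
    then show ?thesis using sin_ge_half[of "pi - x"] x cR by auto
  qed
  have "cos x \<le> 1" by simp
  \<comment> \<open>This is where \<open>c \<ge> 4 / M\<close> enters: it lets half of the mass term
    absorb \<open>cos x\<close>.\<close>
  also have "1 \<le> M * R / 2 * (c / R / 2)"
    using c M R by (simp add: field_simps)
  also have "\<dots> \<le> M * R / 2 * sin x"
    using sinx M R by (intro mult_left_mono) auto
  finally have "M * R / 2 * sin x \<le> M * R * sin x - cos x" by (simp add: algebra_simps)
  then have "r0 * (M * R / 2 * sin x) \<le> r0 * (M * R * sin x - cos x)"
    using r0(1) by (intro mult_left_mono) auto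
  then have "r * r1 * (M * R / 2 * sin y) \<le> r * r1 * cos y"
    unfolding e2 using e1 by (simp add: algebra_simps)
  then have tan: "M * R / 2 * sin y \<le> cos y"
    using r(1) r1(1) by (simp add: mult_le_cancel_left)
  have "y \<le> pi / 2"
  proof (rule ccontr)
    assume "\<not> y \<le> pi / 2"
    then have "cos y \<le> cos (pi / 2)" using y by (intro cos_monotone_0_pi_le) auto
    moreover have "sin y > 0" using y by (rule sin_gt_zero)
    moreover have "M * R / 2 * sin y > 0" using \<open>sin y > 0\<close> M R by simp
    ultimately show False using tan by simp
  qed
  then have "M * R / 2 * (y / 2) \<le> M * R / 2 * sin y"
    using sin_ge_half[of y] y M R by (intro mult_left_mono) auto
  also have "\<dots> \<le> 1" using tan cos_le_one[of y] by linarith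
  finally have "y \<le> 4 / M / R" using M R by (simp add: field_simps)
  also have "\<dots> \<le> c / R" using c R by (intro divide_right_mono) auto
  finally show "of_int (k + 1) * pi - c / R \<le> rescaled_angle R (\<theta> 1)" by (simp add: y_def)
qed

section \<open>The total angle of a loaded string\<close>

text \<open>\<open>g j\<close> names the continuous extension of \<open>q\<close> from the open
  \<open>j\<close>-th interval to the closed one; the length is written
  \<open>a (Suc N)\<close>.\<close>

locale string_with_masses =
  fixes N :: nat and a M :: "nat \<Rightarrow> real" and q :: "real \<Rightarrow> real" and g :: "nat \<Rightarrow> real \<Rightarrow> real"
  assumes a_0: "a 0 = 0"
    and a_Suc: "j \<le> N \<Longrightarrow> a j < a (Suc j)"
    and M_pos: "j \<in> {1..N} \<Longrightarrow> 0 < M j"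
    and g_cont: "j \<le> N \<Longrightarrow> continuous_on {a j..a (Suc j)} (g j)"
    and g_eq: "j \<le> N \<Longrightarrow> x \<in> {a j<..<a (Suc j)} \<Longrightarrow> g j x = q x"
begin

abbreviation pot :: "real \<Rightarrow> nat \<Rightarrow> real \<Rightarrow> real" where
  "pot \<mu> j \<equiv> (\<lambda>t. \<mu> - g j t)"

text \<open>\<open>start_angle \<mu> j\<close> is the Pruefer angle to the right of \<open>a j\<close>, that is, after the mass \<open>M j\<close>.\<close>

primrec start_angle :: "real \<Rightarrow> nat \<Rightarrow> real" where
  "start_angle \<mu> 0 = 0"
| "start_angle \<mu> (Suc j) = prufer_flow 0 (\<lambda>_. M (Suc j) * \<mu>) 0 1
     (prufer_flow 1 (pot \<mu> j) (a j) (a (Suc j)) (start_angle \<mu> j))"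

definition angle :: "real \<Rightarrow> nat \<Rightarrow> real \<Rightarrow> real" where
  "angle \<mu> j = prufer_path 1 (pot \<mu> j) (a j) (a (Suc j)) (start_angle \<mu> j)"

definition end_angle :: "real \<Rightarrow> nat \<Rightarrow> real" where
  "end_angle \<mu> j = angle \<mu> j (a (Suc j))"

definition mass_angle :: "real \<Rightarrow> nat \<Rightarrow> real \<Rightarrow> real" where
  "mass_angle \<mu> j = prufer_path 0 (\<lambda>_. M (Suc j) * \<mu>) 0 1 (end_angle \<mu> j)"

lemma pot_cont: "j \<le> N \<Longrightarrow> continuous_on {a j..a (Suc j)} (pot \<mu> j)"
  by (intro continuous_intros g_cont)

lemma angle:
  assumes "j \<le> N"
  shows "prufer 1 (pot \<mu> j) (a j) (a (Suc j)) (angle \<mu> j)" "angle \<mu> j (a j) = start_angle \<mu> j"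
  unfolding angle_def
  using prufer_path[OF less_imp_le[OF a_Suc[OF assms]] pot_cont[OF assms]] by blast+

lemma mass_angle:
  "prufer 0 (\<lambda>_. M (Suc j) * \<mu>) 0 1 (mass_angle \<mu> j)"
  "mass_angle \<mu> j 0 = end_angle \<mu> j" "mass_angle \<mu> j 1 = start_angle \<mu> (Suc j)"
  using prufer_path[of 0 1 "\<lambda>_. M (Suc j) * \<mu>"]
  by (auto simp: mass_angle_def end_angle_def angle_def)

lemma a_mono: "i < k \<Longrightarrow> k \<le> Suc N \<Longrightarrow> a i < a k"
proof (induction k)
  case (Suc k)
  then show ?case using a_Suc[of k] by (cases "i = k") auto
qed simp

lemma a_mono_le: "i \<le> k \<Longrightarrow> k \<le> Suc N \<Longrightarrow> a i \<le> a k"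
  using a_mono[of i k] by (cases "i = k") auto

lemma cover:
  assumes "x \<in> {0..a (Suc N)}"
  obtains j where "j \<le> N" "x \<in> {a j..a (Suc j)}"
proof -
  have "n \<le> N \<Longrightarrow> x \<in> {0..a (Suc n)} \<Longrightarrow> \<exists>j\<le>N. x \<in> {a j..a (Suc j)}" for n
  proof (induction n)
    case 0
    then show ?case using a_0 by auto
  next
    case (Suc n)
    then show ?case by (cases "x \<le> a (Suc n)") auto
  qed
  with assms that show thesis by blast
qed

section \<open>Dependence of the total angle on the spectral parameter\<close>

text \<open>The angle starts at 0 for every parameter, so the induction carries only the weak order
  through the masses; each string, having \<open>p = 1\<close> and a strictly larger potential term,
  makes it strict.\<close>

lemma angle_mono:
  assumes "\<mu> < \<nu>"
  shows "j \<le> N \<Longrightarrow> start_angle \<mu> j \<le> start_angle \<nu> j"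
    and "j \<le> N \<Longrightarrow> end_angle \<mu> j < end_angle \<nu> j"
proof -
  have seg: "end_angle \<mu> j < end_angle \<nu> j" if "j \<le> N" "start_angle \<mu> j \<le> start_angle \<nu> j" for j
    unfolding end_angle_def
    by (rule prufer_strict_mono_potential[OF a_Suc[OF that(1)] _ angle(1)[OF that(1)]
          angle(1)[OF that(1)] pot_cont[OF that(1)]])
      (use assms that angle(2) in auto)
  show start: "start_angle \<mu> j \<le> start_angle \<nu> j" if "j \<le> N" for j
    using that
  proof (induction j)
    case (Suc j)
    have "mass_angle \<mu> j 1 \<le> mass_angle \<nu> j 1"
      by (rule prufer_mono[OF zero_less_one mass_angle(1) mass_angle(1)])
        (use Suc seg[of j] assms M_pos[of "Suc j"] mass_angle(2) in \<open>auto intro: less_imp_le\<close>)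
    then show ?case by (simp only: mass_angle(3))
  qed simp
  show "end_angle \<mu> j < end_angle \<nu> j" if "j \<le> N" for j
    using seg start that by blast
qed

lemma angle_continuous:
  shows "j \<le> N \<Longrightarrow> continuous_on UNIV (\<lambda>\<mu>. start_angle \<mu> j)"
    and "j \<le> N \<Longrightarrow> continuous_on UNIV (\<lambda>\<mu>. end_angle \<mu> j)"
proof -
  have seg: "continuous_on UNIV (\<lambda>\<mu>. end_angle \<mu> j)"
    if "j \<le> N" "continuous_on UNIV (\<lambda>\<mu>. start_angle \<mu> j)" for j
    unfolding end_angle_def angle_def
    by (rule prufer_flow_continuous[OF a_Suc[OF that(1)] that(2) pot_cont[OF that(1)], where B = 1]) simp
  show start: "continuous_on UNIV (\<lambda>\<mu>. start_angle \<mu> j)" if "j \<le> N" for j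
    using that
  proof (induction j)
    case (Suc j)
    have "continuous_on UNIV (\<lambda>\<mu>. prufer_flow 0 (\<lambda>_. M (Suc j) * \<mu>) 0 1 (end_angle \<mu> j))"
      by (rule prufer_flow_continuous[where B = "M (Suc j)"])
        (use Suc seg[of j] M_pos[of "Suc j"] in \<open>auto simp: abs_mult simp flip: right_diff_distrib\<close>)
    then show ?case by (simp add: end_angle_def angle_def)
  qed simp
  show "continuous_on UNIV (\<lambda>\<mu>. end_angle \<mu> j)" if "j \<le> N" for j
    using seg start that by blast
qed

text \<open>A string lifts any nonnegative start angle strictly above 0, and a mass keeps it there.
  This excludes nonpositive multiples of pi as end angles.\<close>

lemma angle_pos:
  shows "j \<le> N \<Longrightarrow> 0 \<le> start_angle \<mu> j" and "j \<le> N \<Longrightarrow> 0 < end_angle \<mu> j"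
proof -
  have seg: "0 < end_angle \<mu> j" if "j \<le> N" "0 \<le> start_angle \<mu> j" for j
    using prufer_gt_npi[OF a_Suc[OF that(1)] angle(1)[OF that(1)] pot_cont[OF that(1)], of 0] that angle(2)
    by (simp add: end_angle_def)
  show start: "0 \<le> start_angle \<mu> j" if "j \<le> N" for j
    using that
  proof (induction j)
    case (Suc j)
    then show ?case
      using prufer_mass_gt_npi[OF mass_angle(1), of 0 \<mu> j] seg[of j]
      by (simp only: mass_angle) simp
  qed simp
  show "0 < end_angle \<mu> j" if "j \<le> N" for j
    using seg start that by blast
qed

lemma g_bound:
  obtains Q where "Q > 0" "\<And>j t. j \<le> N \<Longrightarrow> t \<in> {a j..a (Suc j)} \<Longrightarrow> \<bar>g j t\<bar> \<le> Q"
proof -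
  have "\<forall>j. \<exists>K. j \<le> N \<longrightarrow> K > 0 \<and> (\<forall>t\<in>{a j..a (Suc j)}. \<bar>g j t\<bar> \<le> K)"
  proof
    fix j
    show "\<exists>K. j \<le> N \<longrightarrow> K > 0 \<and> (\<forall>t\<in>{a j..a (Suc j)}. \<bar>g j t\<bar> \<le> K)"
    proof (cases "j \<le> N")
      case True
      obtain K where "K > 0" "\<And>t. t \<in> {a j..a (Suc j)} \<Longrightarrow> \<bar>g j t\<bar> \<le> K"
        by (rule continuous_on_bound[OF g_cont[OF True]]) auto
      then show ?thesis by auto
    qed simp
  qed
  then obtain K where K: "\<And>j. j \<le> N \<Longrightarrow> K j > 0" "\<And>j t. j \<le> N \<Longrightarrow> t \<in> {a j..a (Suc j)} \<Longrightarrow> \<bar>g j t\<bar> \<le> K j"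
    unfolding choice_iff by blast
  have le: "K j \<le> (\<Sum>i\<le>N. K i)" if "j \<le> N" for j
    using K(1) that by (intro member_le_sum) (auto intro: less_imp_le)
  show thesis
  proof (rule that)
    show "0 < (\<Sum>i\<le>N. K i)" using K(1) by (intro sum_pos) auto
    show "\<bar>g j t\<bar> \<le> (\<Sum>i\<le>N. K i)" if "j \<le> N" "t \<in> {a j..a (Suc j)}" for j t
      using K(2)[OF that] le[OF that(1)] by simp
  qed
qed

text \<open>At the angle \<open>pi / 4\<close> the squares of sine and cosine are equal, so for
  \<mu> = - (1 + Q) the right-hand side is (1 + \<mu> - g) / 2 \<le> 0 on a string and M \<mu> / 2 <
  0 at a mass. The constant \<open>pi / 4\<close> is a supersolution everywhere.\<close>

lemma end_angle_small: "\<exists>\<mu>. end_angle \<mu> N < pi"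
proof -
  obtain Q where Q: "Q > 0" "\<And>j t. j \<le> N \<Longrightarrow> t \<in> {a j..a (Suc j)} \<Longrightarrow> \<bar>g j t\<bar> \<le> Q"
    using g_bound by blast
  define \<mu> where "\<mu> = - (1 + Q)"
  have seg: "end_angle \<mu> j \<le> pi / 4" if j: "j \<le> N" "start_angle \<mu> j \<le> pi / 4" for j
    unfolding end_angle_def
  proof (rule prufer_supersolution[OF angle(1)[OF j(1)] pot_cont[OF j(1)], where z = "\<lambda>_. pi / 4" and z' = "\<lambda>_. 0"])
    fix t assume "a j < t" "t < a (Suc j)"
    then have "\<bar>g j t\<bar> \<le> Q" using Q(2)[of j t] j by auto
    then show "1 * (cos (pi / 4))\<^sup>2 + (\<mu> - g j t) * (sin (pi / 4))\<^sup>2 \<le> 0"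
      by (simp add: cos_45 sin_45 power_divide \<mu>_def abs_le_iff field_simps)
  qed (use j a_Suc[of j] angle(2)[of j] in auto)
  have start: "start_angle \<mu> j \<le> pi / 4" if "j \<le> N" for j
    using that
  proof (induction j)
    case (Suc j)
    have "mass_angle \<mu> j 1 \<le> pi / 4"
    proof (rule prufer_supersolution[OF mass_angle(1), where z = "\<lambda>_. pi / 4" and z' = "\<lambda>_. 0"])
      show "0 * (cos (pi / 4))\<^sup>2 + M (Suc j) * \<mu> * (sin (pi / 4))\<^sup>2 \<le> 0"
        using M_pos[of "Suc j"] Suc.prems Q(1) by (simp add: \<mu>_def mult_le_0_iff zero_le_mult_iff)
    qed (use Suc seg[of j] mass_angle(2) in auto)
    then show ?case by (simp only: mass_angle(3))
  qed simp
  have "end_angle \<mu> N \<le> pi / 4" by (rule seg[OF order_refl start[OF order_refl]])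
  also have "\<dots> < pi" by simp
  finally show ?thesis by blast
qed

section \<open>Eigenvalues as zeros of the sine of the total angle\<close>

definition solves :: "real \<Rightarrow> nat \<Rightarrow> (real \<Rightarrow> real) \<Rightarrow> (real \<Rightarrow> real) \<Rightarrow> bool" where
  "solves \<mu> j u w \<longleftrightarrow> continuous_on {a j..a (Suc j)} u \<and> continuous_on {a j..a (Suc j)} w \<and>
     (\<forall>t\<in>{a j<..<a (Suc j)}. (u has_real_derivative w t) (at t) \<and>
        (w has_real_derivative - (\<mu> - g j t) * u t) (at t))"

text \<open>The polar pieces of the strings, suitably scaled, fit together at the masses. Amplitudes
  stay positive, so the solution vanishes at the right end exactly where the sine of the angle does.
  A pair per string gives \<open>w\<close> both of its one-sided values at a mass.\<close>

lemma fundamental_solution: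
  "\<exists>u w. (\<forall>j\<le>N. solves \<mu> j (u j) (w j)) \<and> u 0 0 = 0 \<and> w 0 0 = 1 \<and>
     (\<forall>j<N. u (Suc j) (a (Suc j)) = u j (a (Suc j)) \<and>
        w (Suc j) (a (Suc j)) = w j (a (Suc j)) - M (Suc j) * \<mu> * u j (a (Suc j))) \<and>
     (u N (a (Suc N)) = 0 \<longleftrightarrow> sin (end_angle \<mu> N) = 0)"
proof -
  have "\<forall>j. \<exists>\<rho>. j \<le> N \<longrightarrow> (continuous_on {a j..a (Suc j)} \<rho> \<and> (\<forall>t. \<rho> t > 0) \<and> \<rho> (a j) = 1 \<and>
    (\<forall>t\<in>{a j<..<a (Suc j)}.
       ((\<lambda>t. \<rho> t * sin (angle \<mu> j t)) has_real_derivative 1 * (\<rho> t * cos (angle \<mu> j t))) (at t) \<and>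
       ((\<lambda>t. \<rho> t * cos (angle \<mu> j t)) has_real_derivative - (\<mu> - g j t) * (\<rho> t * sin (angle \<mu> j t))) (at t)))"
    using prufer_amplitude[OF angle(1) pot_cont] by blast
  then obtain \<rho> where \<rho>: "\<And>j. j \<le> N \<Longrightarrow> continuous_on {a j..a (Suc j)} (\<rho> j)" "\<And>j t. j \<le> N \<Longrightarrow> \<rho> j t > 0"
      "\<And>j. j \<le> N \<Longrightarrow> \<rho> j (a j) = 1"
    and \<rho>1: "\<And>j t. j \<le> N \<Longrightarrow> t \<in> {a j<..<a (Suc j)} \<Longrightarrow>
       ((\<lambda>t. \<rho> j t * sin (angle \<mu> j t)) has_real_derivative 1 * (\<rho> j t * cos (angle \<mu> j t))) (at t)"
    and \<rho>2: "\<And>j t. j \<le> N \<Longrightarrow> t \<in> {a j<..<a (Suc j)} \<Longrightarrow>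
       ((\<lambda>t. \<rho> j t * cos (angle \<mu> j t)) has_real_derivative - (\<mu> - g j t) * (\<rho> j t * sin (angle \<mu> j t))) (at t)"
    unfolding choice_iff by blast
  have "\<forall>j. \<exists>r>0. r * sin (start_angle \<mu> (Suc j)) = sin (end_angle \<mu> j) \<and>
      r * cos (start_angle \<mu> (Suc j)) = cos (end_angle \<mu> j) - M (Suc j) * \<mu> * sin (end_angle \<mu> j)"
    using prufer_mass[OF mass_angle(1)] unfolding mass_angle(2,3) by blast
  then obtain r where r: "\<And>j. r j > 0" "\<And>j. r j * sin (start_angle \<mu> (Suc j)) = sin (end_angle \<mu> j)"
      "\<And>j. r j * cos (start_angle \<mu> (Suc j)) = cos (end_angle \<mu> j) - M (Suc j) * \<mu> * sin (end_angle \<mu> j)"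
    unfolding choice_iff by blast
  \<comment> \<open>The scale of string \<open>j\<close> collects the final amplitudes of the
    earlier strings and the factors \<open>r\<close> of the masses, which makes \<open>u\<close>
    continuous and gives \<open>w\<close> its jump.\<close>
  define A where "A = rec_nat 1 (\<lambda>j x. x * \<rho> j (a (Suc j)) * r j)"
  have A: "A 0 = 1" "\<And>j. A (Suc j) = A j * \<rho> j (a (Suc j)) * r j" by (simp_all add: A_def)
  have Apos: "j \<le> N \<Longrightarrow> A j > 0" for j
    by (induction j) (auto simp: A \<rho>(2) r(1))
  define u where "u j t = A j * (\<rho> j t * sin (angle \<mu> j t))" for j t
  define w where "w j t = A j * (\<rho> j t * cos (angle \<mu> j t))" for j t
  show ?thesis
  proof (rule exI[of _ u], rule exI[of _ w], intro conjI allI impI)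
    show "solves \<mu> j (u j) (w j)" if j: "j \<le> N" for j
      unfolding solves_def
    proof (intro conjI ballI)
      show "continuous_on {a j..a (Suc j)} (u j)" "continuous_on {a j..a (Suc j)} (w j)"
        unfolding u_def w_def by (intro continuous_intros \<rho>(1) j pruferD(1)[OF angle(1)])+
      fix t assume t: "t \<in> {a j<..<a (Suc j)}"
      show "(u j has_real_derivative w j t) (at t)"
        unfolding u_def w_def using DERIV_cmult[OF \<rho>1[OF j t], of "A j"] by simp
      show "(w j has_real_derivative - (\<mu> - g j t) * u j t) (at t)"
        unfolding u_def w_def using DERIV_cmult[OF \<rho>2[OF j t], of "A j"] by (simp add: mult_ac)
    qed
    show "u 0 0 = 0" "w 0 0 = 1"
      using angle(2)[of 0 \<mu>] \<rho>(3)[of 0] by (simp_all add: u_def w_def A a_0)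
    fix j assume j: "j < N"
    have 1: "angle \<mu> (Suc j) (a (Suc j)) = start_angle \<mu> (Suc j)" "\<rho> (Suc j) (a (Suc j)) = 1"
      using angle(2)[of "Suc j" \<mu>] \<rho>(3)[of "Suc j"] j by simp_all
    have "u (Suc j) (a (Suc j)) = A j * \<rho> j (a (Suc j)) * (r j * sin (start_angle \<mu> (Suc j)))"
      by (simp add: u_def A 1 mult_ac del: start_angle.simps)
    then show eq: "u (Suc j) (a (Suc j)) = u j (a (Suc j))"
      unfolding r(2) by (simp add: u_def end_angle_def)
    have "w (Suc j) (a (Suc j)) = A j * \<rho> j (a (Suc j)) * (r j * cos (start_angle \<mu> (Suc j)))"
      by (simp add: w_def A 1 mult_ac del: start_angle.simps)
    then show "w (Suc j) (a (Suc j)) = w j (a (Suc j)) - M (Suc j) * \<mu> * u j (a (Suc j))"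
      unfolding r(3) by (simp add: u_def w_def end_angle_def algebra_simps)
  next
    show "u N (a (Suc N)) = 0 \<longleftrightarrow> sin (end_angle \<mu> N) = 0"
      using Apos[of N] \<rho>(2)[of N "a (Suc N)"] by (simp add: u_def end_angle_def)
  qed
qed

text \<open>Transfers endpoint values to one-sided limits of a function known only inside, such as
  the derivative \<psi> of an eigenfunction at the masses.\<close>

lemma tendsto_endpoints_of_eq_interior:
  assumes "continuous_on {\<alpha>..\<beta>} (f :: real \<Rightarrow> 'b :: real_normed_vector)" "\<alpha> < \<beta>" "\<And>x. x \<in> {\<alpha><..<\<beta>} \<Longrightarrow> h x = f x"
  shows "(h \<longlongrightarrow> f \<alpha>) (at_right \<alpha>)" "(h \<longlongrightarrow> f \<beta>) (at_left \<beta>)"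
proof -
  have "(f \<longlongrightarrow> f \<alpha>) (at_right \<alpha>)" "(f \<longlongrightarrow> f \<beta>) (at_left \<beta>)"
    using continuous_on_Icc_at_rightD[OF assms(1,2)] continuous_on_Icc_at_leftD[OF assms(1,2)] .
  moreover have "\<forall>\<^sub>F x in at_right \<alpha>. f x = h x" "\<forall>\<^sub>F x in at_left \<beta>. f x = h x"
    using assms(2,3) eventually_at_right_real[of \<alpha> \<beta>] eventually_at_left_real[of \<alpha> \<beta>]
    by (auto elim: eventually_mono)
  ultimately show "(h \<longlongrightarrow> f \<alpha>) (at_right \<alpha>)" "(h \<longlongrightarrow> f \<beta>) (at_left \<beta>)"
    by (blast intro: Lim_transform_eventually)+
qed

text \<open>The fundamental solution then vanishes at the right end as well, so gluing its pieces
  gives an eigenfunction.\<close>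

lemma eigenvalue_if_sin_zero:
  assumes "sin (end_angle \<mu> N) = 0"
  shows "complex_of_real \<mu> \<in> eigenvalues N a (a (Suc N)) M q"
proof -
  obtain u w where sol: "\<forall>j\<le>N. solves \<mu> j (u j) (w j)" and init: "u 0 0 = 0" "w 0 0 = 1"
    and jump: "\<forall>j<N. u (Suc j) (a (Suc j)) = u j (a (Suc j)) \<and>
        w (Suc j) (a (Suc j)) = w j (a (Suc j)) - M (Suc j) * \<mu> * u j (a (Suc j))"
    and fin: "u N (a (Suc N)) = 0 \<longleftrightarrow> sin (end_angle \<mu> N) = 0"
    using fundamental_solution[of \<mu>] by blast
  note solD = sol[unfolded solves_def, rule_format]
  \<comment> \<open>Index of the string containing \<open>x\<close>: a mass point belongs to the
    string on its right, while the right end, not being a mass, stays with string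
    \<open>N\<close>.\<close>
  define seg where "seg x = card {i \<in> {1..N}. a i \<le> x}" for x
  have seg: "seg x = j" if "j \<le> N" "x \<in> {a j..<a (Suc j)}" for j x
  proof -
    have "a i \<le> x \<longleftrightarrow> i \<le> j" if "i \<in> {1..N}" for i
      using a_mono_le[of i j] a_mono_le[of "Suc j" i] that \<open>j \<le> N\<close> \<open>x \<in> _\<close> by (cases "i \<le> j") auto
    then have "{i \<in> {1..N}. a i \<le> x} = {1..j}" using that(1) by auto
    then show ?thesis by (simp add: seg_def)
  qed
  have segN: "seg (a (Suc N)) = N"
  proof -
    have "{i \<in> {1..N}. a i \<le> a (Suc N)} = {1..N}" using a_mono_le[of _ "Suc N"] by auto
    then show ?thesis by (simp add: seg_def)
  qed
  define \<phi> where "\<phi> x = complex_of_real (u (seg x) x)" for x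
  define \<psi> where "\<psi> x = complex_of_real (w (seg x) x)" for x
  define \<xi> where "\<xi> x = complex_of_real (- (\<mu> - q x) * u (seg x) x)" for x
  have \<phi>_seg: "\<phi> x = complex_of_real (u j x)" if "j \<le> N" "x \<in> {a j..a (Suc j)}" for j x
  proof (cases "x = a (Suc j)")
    case True
    show ?thesis
    proof (cases "j = N")
      case True
      then show ?thesis using \<open>x = a (Suc j)\<close> segN by (simp add: \<phi>_def)
    next
      case False
      then have "j < N" using that by simp
      then have "seg x = Suc j" using a_Suc[of "Suc j"] by (intro seg) (auto simp: True)
      then show ?thesis using jump \<open>j < N\<close> True by (simp add: \<phi>_def)
    qed
  next
    case False
    then show ?thesis using seg[of j x] that by (simp add: \<phi>_def)
  qed
  have cont: "continuous_on {0..a (Suc N)} \<phi>"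
  proof -
    have "continuous_on (\<Union>j\<in>{..N}. {a j..a (Suc j)}) \<phi>"
    proof (rule continuous_on_closed_Union)
      fix j assume "j \<in> {..N}"
      then have j: "j \<le> N" by simp
      have "continuous_on {a j..a (Suc j)} (\<lambda>x. complex_of_real (u j x))"
        using solD[OF j] by (intro continuous_intros) auto
      then show "continuous_on {a j..a (Suc j)} \<phi>"
        by (rule continuous_on_eq) (use \<phi>_seg[OF j] in auto)
    qed auto
    then show ?thesis by (rule continuous_on_subset) (auto elim!: cover)
  qed
  have interior: "\<exists>j\<le>N. x \<in> {a j<..<a (Suc j)}" if x: "x \<in> {0<..<a (Suc N)} - a ` {1..N}" for x
  proof -
    obtain j where j: "j \<le> N" "x \<in> {a j..a (Suc j)}" by (rule cover[of x]) (use x in auto)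
    have "x \<noteq> a j" using x j(1) a_0 by (cases j) auto
    moreover have "x \<noteq> a (Suc j)" using x j(1) by (cases "j = N") auto
    ultimately show ?thesis using j by force
  qed
  have bc: "\<phi> 0 = 0" "\<phi> (a (Suc N)) = 0"
    using \<phi>_seg[of 0 0] a_Suc[of 0] init \<phi>_seg[of N "a (Suc N)"] a_Suc[of N] fin assms by (simp_all add: a_0)
  \<comment> \<open>If \<open>u 0\<close> vanished on the first string, \<open>w 0\<close> would be
    constant there with its initial value 1, but also equal to the derivative 0 of
    \<open>u 0\<close>.\<close>
  have nz: "\<exists>x\<in>{0..a (Suc N)}. \<phi> x \<noteq> 0"
    proof (rule ccontr)
      assume "\<not> (\<exists>x\<in>{0..a (Suc N)}. \<phi> x \<noteq> 0)"
      then have zero: "u 0 x = 0" if "x \<in> {0..a 1}" for x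
        using \<phi>_seg[of 0 x] that a_mono_le[of 1 "Suc N"] a_0 by auto
      have pos: "0 < a 1" using a_Suc[of 0] a_0 by simp
      have sol0: "continuous_on {0..a 1} (w 0)" "\<And>t. 0 < t \<Longrightarrow> t < a 1 \<Longrightarrow> (u 0 has_real_derivative w 0 t) (at t)"
         "\<And>t. 0 < t \<Longrightarrow> t < a 1 \<Longrightarrow> (w 0 has_real_derivative 0) (at t)"
        using solD[of 0] zero by (auto simp: a_0)
      define m where "m = a 1 / 2"
      have m: "0 < m" "m < a 1" using pos by (auto simp: m_def)
      have "w 0 m = w 0 0"
        by (rule DERIV_isconst2[OF pos sol0(1)]) (use sol0(3) m in auto)
      moreover have "(u 0 has_real_derivative 0) (at m)"
        by (rule has_field_derivative_transform_within_open[of "\<lambda>_. 0" _ _ "{0<..<a 1}"]) (use m zero in auto)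
      then have "w 0 m = 0" using sol0(2)[OF m] DERIV_unique by blast
      ultimately show False using init by simp
    qed
  have ode: "(\<phi> has_vector_derivative \<psi> x) (at x) \<and> (\<psi> has_vector_derivative \<xi> x) (at x) \<and>
      - \<xi> x + of_real (q x) * \<phi> x = of_real \<mu> * \<phi> x"
    if x: "x \<in> {0<..<a (Suc N)} - a ` {1..N}" for x
  proof (intro conjI)
    obtain j where j: "j \<le> N" "x \<in> {a j<..<a (Suc j)}" using interior[OF x] by blast
    have seg_j: "seg y = j" if "y \<in> {a j<..<a (Suc j)}" for y using seg[OF j(1), of y] that by auto
    have u: "(u j has_real_derivative w j x) (at x)" "(w j has_real_derivative - (\<mu> - g j x) * u j x) (at x)"
      using solD[OF j(1)] j(2) by auto
    show "(\<phi> has_vector_derivative \<psi> x) (at x)"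
      unfolding \<psi>_def seg_j[OF j(2)]
      by (rule has_vector_derivative_transform_within_open[OF has_vector_derivative_of_real[OF u(1)] _ j(2)])
        (auto simp: \<phi>_def seg_j)
    show "(\<psi> has_vector_derivative \<xi> x) (at x)"
      unfolding \<xi>_def seg_j[OF j(2)] g_eq[OF j, symmetric]
      by (rule has_vector_derivative_transform_within_open[OF has_vector_derivative_of_real[OF u(2)] _ j(2)])
        (auto simp: \<psi>_def seg_j)
    show "- \<xi> x + of_real (q x) * \<phi> x = of_real \<mu> * \<phi> x"
      by (simp add: \<xi>_def \<phi>_def algebra_simps)
  qed
  have jumps: "\<exists>dl dr. (\<psi> \<longlongrightarrow> dl) (at_left (a j)) \<and> (\<psi> \<longlongrightarrow> dr) (at_right (a j)) \<and>
      dr = dl - of_real (M j) * of_real \<mu> * \<phi> (a j)" if j: "j \<in> {1..N}" for j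
  proof -
    obtain i where i: "j = Suc i" "i < N" using j by (cases j) auto
    have "(\<psi> \<longlongrightarrow> complex_of_real (w i (a j))) (at_left (a j))"
      unfolding i(1)
      by (rule tendsto_endpoints_of_eq_interior(2)[of "a i" _ "\<lambda>x. complex_of_real (w i x)"])
        (use solD[of i] i a_Suc[of i] seg[of i] in \<open>auto intro!: continuous_intros simp: \<psi>_def\<close>)
    moreover have "(\<psi> \<longlongrightarrow> complex_of_real (w j (a j))) (at_right (a j))"
      by (rule tendsto_endpoints_of_eq_interior(1)[of _ "a (Suc j)" "\<lambda>x. complex_of_real (w j x)"])
        (use solD[of j] i a_Suc[of j] seg[of j] in \<open>auto intro!: continuous_intros simp: \<psi>_def\<close>)
    moreover have "complex_of_real (w j (a j))
        = complex_of_real (w i (a j)) - of_real (M j) * of_real \<mu> * \<phi> (a j)"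
      using jump i(2) \<phi>_seg[of i "a j"] a_Suc[of i] i by simp
    ultimately show ?thesis by blast
  qed
  have "eigenfunction N a (a (Suc N)) M q (complex_of_real \<mu>) \<phi>"
    unfolding eigenfunction_def using nz cont bc ode jumps by blast
  then show ?thesis by (auto simp: eigenvalues_def)
qed

text \<open>Every eigenfunction is a complex multiple \<rho> of the fundamental solution: uniqueness
  for the linear system gives this on each string, and both obey the same jumps. As \<rho> is not 0,
  the fundamental solution vanishes at the right end.\<close>

lemma sin_zero_if_eigenvalue:
  assumes "complex_of_real \<mu> \<in> eigenvalues N a (a (Suc N)) M q"
  shows "sin (end_angle \<mu> N) = 0"
proof -
  obtain \<phi> where "eigenfunction N a (a (Suc N)) M q (complex_of_real \<mu>) \<phi>"
    using assms by (auto simp: eigenvalues_def)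
  then obtain \<psi> \<xi> where nz: "\<exists>x\<in>{0..a (Suc N)}. \<phi> x \<noteq> 0" and cont: "continuous_on {0..a (Suc N)} \<phi>"
    and bc: "\<phi> 0 = 0" "\<phi> (a (Suc N)) = 0"
    and odes: "\<forall>x\<in>{0<..<a (Suc N)} - a ` {1..N}. (\<phi> has_vector_derivative \<psi> x) (at x) \<and>
        (\<psi> has_vector_derivative \<xi> x) (at x) \<and> - \<xi> x + of_real (q x) * \<phi> x = of_real \<mu> * \<phi> x"
    and jumps: "\<forall>j\<in>{1..N}. \<exists>dl dr. (\<psi> \<longlongrightarrow> dl) (at_left (a j)) \<and> (\<psi> \<longlongrightarrow> dr) (at_right (a j)) \<and>
        dr = dl - of_real (M j) * of_real \<mu> * \<phi> (a j)"
    unfolding eigenfunction_def by blast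
  have ode: "(\<phi> has_vector_derivative \<psi> x) (at x)" "(\<psi> has_vector_derivative \<xi> x) (at x)"
    "- \<xi> x + of_real (q x) * \<phi> x = of_real \<mu> * \<phi> x"
    if "x \<in> {0<..<a (Suc N)} - a ` {1..N}" for x using odes that by blast+
  obtain u w where sol: "\<forall>j\<le>N. solves \<mu> j (u j) (w j)" and init: "u 0 0 = 0" "w 0 0 = 1"
    and jump: "\<forall>j<N. u (Suc j) (a (Suc j)) = u j (a (Suc j)) \<and>
        w (Suc j) (a (Suc j)) = w j (a (Suc j)) - M (Suc j) * \<mu> * u j (a (Suc j))"
    and fin: "u N (a (Suc N)) = 0 \<longleftrightarrow> sin (end_angle \<mu> N) = 0"
    using fundamental_solution[of \<mu>] by blast
  note solD = sol[unfolded solves_def, rule_format]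
  have inside: "x \<in> {0<..<a (Suc N)} - a ` {1..N}" if j: "j \<le> N" "x \<in> {a j<..<a (Suc j)}" for j x
  proof -
    have "0 < x" using a_mono_le[of 0 j] a_0 j by auto
    moreover have "x < a (Suc N)" using a_mono_le[of "Suc j" "Suc N"] j by auto
    moreover have "x \<noteq> a i" if "i \<in> {1..N}" for i
      using a_mono_le[of i j] a_mono_le[of "Suc j" i] that j by (cases "i \<le> j") auto
    ultimately show ?thesis by (metis DiffI greaterThanLessThan_iff imageE)
  qed
  have cont_j: "continuous_on {a j..a (Suc j)} \<phi>" if "j \<le> N" for j
    by (rule continuous_on_subset[OF cont])
      (use that a_mono_le[of 0 j] a_mono_le[of "Suc j" "Suc N"] a_0 in auto)
  \<comment> \<open>The derivative \<psi> is controlled only inside the string. An antiderivative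
    \<open>H\<close> of the continuous function -(\<mu> - g) \<phi> lives on the closed string and
    differs from \<psi> by a constant, which yields a continuous extension of \<psi>.\<close>
  have extend: "\<exists>\<psi>'. continuous_on {a j..a (Suc j)} \<psi>' \<and> (\<forall>x\<in>{a j<..<a (Suc j)}. \<psi>' x = \<psi> x \<and>
      (\<psi>' has_vector_derivative (- (\<mu> - g j x)) *\<^sub>R \<phi> x) (at x))" if j: "j \<le> N" for j
  proof -
    have "continuous_on {a j..a (Suc j)} (\<lambda>x. (- (\<mu> - g j x)) *\<^sub>R \<phi> x)"
      by (intro continuous_intros cont_j[OF j] g_cont[OF j])
    then obtain H where H: "\<And>x. x \<in> {a j..a (Suc j)} \<Longrightarrow>
        (H has_vector_derivative (- (\<mu> - g j x)) *\<^sub>R \<phi> x) (at x within {a j..a (Suc j)})"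
      using antiderivative_continuous by blast
    have H': "(H has_vector_derivative (- (\<mu> - g j x)) *\<^sub>R \<phi> x) (at x)" if "x \<in> {a j<..<a (Suc j)}" for x
      using H[of x] that at_within_interior[of x "{a j..a (Suc j)}"] by auto
    have \<psi>': "(\<psi> has_vector_derivative (- (\<mu> - g j x)) *\<^sub>R \<phi> x) (at x)" if x: "x \<in> {a j<..<a (Suc j)}" for x
    proof -
      have "\<xi> x = (- (\<mu> - g j x)) *\<^sub>R \<phi> x"
        using ode(3)[OF inside[OF j x]] g_eq[OF j x] by (simp add: scaleR_conv_of_real algebra_simps)
      with ode(2)[OF inside[OF j x]] show ?thesis by simp
    qed
    have "\<exists>c. \<forall>x\<in>{a j<..<a (Suc j)}. \<psi> x - H x = c"
    proof (rule has_derivative_zero_constant)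
      fix x assume x: "x \<in> {a j<..<a (Suc j)}"
      have "((\<lambda>x. \<psi> x - H x) has_vector_derivative 0) (at x)"
        using has_vector_derivative_diff[OF \<psi>'[OF x] H'[OF x]] by simp
      then show "((\<lambda>x. \<psi> x - H x) has_derivative (\<lambda>h. 0)) (at x within {a j<..<a (Suc j)})"
        by (auto simp: has_vector_derivative_def intro: has_derivative_at_withinI)
    qed auto
    then obtain c where c: "\<And>x. x \<in> {a j<..<a (Suc j)} \<Longrightarrow> \<psi> x - H x = c" by blast
    have "continuous_on {a j..a (Suc j)} (\<lambda>x. H x + c)"
      by (intro continuous_intros continuous_on_vector_derivative[OF H])
    moreover have "H x + c = \<psi> x" if "x \<in> {a j<..<a (Suc j)}" for x
      using c[OF that] by (simp add: algebra_simps)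
    moreover have "((\<lambda>x. H x + c) has_vector_derivative (- (\<mu> - g j x)) *\<^sub>R \<phi> x) (at x)"
      if "x \<in> {a j<..<a (Suc j)}" for x
      using has_vector_derivative_add[OF H'[OF that] has_vector_derivative_const[of c]] by simp
    ultimately show ?thesis by blast
  qed
  have propagate: "(\<forall>x\<in>{a j..a (Suc j)}. \<phi> x = \<rho> * of_real (u j x)) \<and>
      (\<psi> \<longlongrightarrow> \<rho> * of_real (w j (a (Suc j)))) (at_left (a (Suc j)))"
    if j: "j \<le> N" and start: "\<phi> (a j) = \<rho> * of_real (u j (a j))"
      "(\<psi> \<longlongrightarrow> \<rho> * of_real (w j (a j))) (at_right (a j))" for j \<rho>
  proof -
    have lt: "a j < a (Suc j)" by (rule a_Suc[OF j])
    obtain \<psi>' where \<psi>': "continuous_on {a j..a (Suc j)} \<psi>'"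
      "\<And>x. x \<in> {a j<..<a (Suc j)} \<Longrightarrow> \<psi>' x = \<psi> x"
      "\<And>x. x \<in> {a j<..<a (Suc j)} \<Longrightarrow> (\<psi>' has_vector_derivative (- (\<mu> - g j x)) *\<^sub>R \<phi> x) (at x)"
      using extend[OF j] by blast
    note lim = tendsto_endpoints_of_eq_interior[OF \<psi>'(1) lt \<psi>'(2)[symmetric]]
    have start': "\<psi>' (a j) = \<rho> * of_real (w j (a j))"
      by (rule tendsto_unique[OF _ lim(1) start(2)]) simp_all
    \<comment> \<open>The differences to the multiple of the fundamental solution solve the linear
      system with zero initial data.\<close>
    define F where "F x = \<phi> x - \<rho> * of_real (u j x)" for x
    define G where "G x = \<psi>' x - \<rho> * of_real (w j x)" for x
    have FG: "F x = 0" "G x = 0" if x: "x \<in> {a j..a (Suc j)}" for x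
    proof -
      have 1: "continuous_on {a j..a (Suc j)} F" "continuous_on {a j..a (Suc j)} G"
        unfolding F_def G_def using solD[OF j] by (auto intro!: continuous_intros cont_j[OF j] \<psi>'(1))
      have 2: "(F has_vector_derivative 1 *\<^sub>R G t) (at t)"
        "(G has_vector_derivative (- (\<mu> - g j t)) *\<^sub>R F t) (at t)" if "a j < t" "t < a (Suc j)" for t
      proof -
        have t: "t \<in> {a j<..<a (Suc j)}" using that by simp
        have "(F has_vector_derivative \<psi>' t - \<rho> * of_real (w j t)) (at t)"
          unfolding F_def \<psi>'(2)[OF t] using solD[OF j] t
          by (intro has_vector_derivative_diff ode(1) inside[OF j t] has_vector_derivative_mult_right
              has_vector_derivative_of_real) auto
        then show "(F has_vector_derivative 1 *\<^sub>R G t) (at t)" by (simp add: G_def)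
        have "(G has_vector_derivative (- (\<mu> - g j t)) *\<^sub>R \<phi> t - \<rho> * of_real (- (\<mu> - g j t) * u j t)) (at t)"
          unfolding G_def using solD[OF j] t
          by (intro has_vector_derivative_diff \<psi>'(3) has_vector_derivative_mult_right
              has_vector_derivative_of_real) auto
        then show "(G has_vector_derivative (- (\<mu> - g j t)) *\<^sub>R F t) (at t)"
          by (simp add: F_def scaleR_conv_of_real algebra_simps)
      qed
      have 3: "F (a j) = 0" "G (a j) = 0" using start start' by (simp_all add: F_def G_def)
      show "F x = 0" by (rule linear_system_unique(1)[OF pot_cont[OF j] 1(1) 2(1) 1(2) 2(2) 3 x])
      show "G x = 0" by (rule linear_system_unique(2)[OF pot_cont[OF j] 1(1) 2(1) 1(2) 2(2) 3 x])
    qed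
    have "\<psi>' (a (Suc j)) = \<rho> * of_real (w j (a (Suc j)))"
      using FG(2)[of "a (Suc j)"] lt by (simp add: G_def)
    with lim(2) FG(1) show ?thesis by (simp add: F_def)
  qed
  obtain \<psi>0 where \<psi>0: "continuous_on {a 0..a (Suc 0)} \<psi>0"
      "\<And>x. x \<in> {a 0<..<a (Suc 0)} \<Longrightarrow> \<psi>0 x = \<psi> x"
    using extend[of 0] by blast
  \<comment> \<open>The initial slope, since the fundamental solution has slope 1 at 0.\<close>
  define \<rho> where "\<rho> = \<psi>0 (a 0)"
  have lim0: "(\<psi> \<longlongrightarrow> \<rho>) (at_right (a 0))"
    unfolding \<rho>_def by (rule tendsto_endpoints_of_eq_interior(1)[OF \<psi>0(1) a_Suc]) (use \<psi>0(2) in auto)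
  have all: "j \<le> N \<Longrightarrow> (\<forall>x\<in>{a j..a (Suc j)}. \<phi> x = \<rho> * of_real (u j x)) \<and>
      (\<psi> \<longlongrightarrow> \<rho> * of_real (w j (a (Suc j)))) (at_left (a (Suc j)))" for j
  proof (induction j)
    case 0
    show ?case by (rule propagate) (use lim0 bc init in \<open>auto simp: a_0\<close>)
  next
    case (Suc j)
    then have IH: "\<And>x. x \<in> {a j..a (Suc j)} \<Longrightarrow> \<phi> x = \<rho> * of_real (u j x)"
      "(\<psi> \<longlongrightarrow> \<rho> * of_real (w j (a (Suc j)))) (at_left (a (Suc j)))" by auto
    obtain dl dr where d: "(\<psi> \<longlongrightarrow> dl) (at_left (a (Suc j)))" "(\<psi> \<longlongrightarrow> dr) (at_right (a (Suc j)))"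
      "dr = dl - of_real (M (Suc j)) * of_real \<mu> * \<phi> (a (Suc j))"
      using jumps[rule_format, of "Suc j"] Suc.prems by auto
    have \<phi>: "\<phi> (a (Suc j)) = \<rho> * of_real (u j (a (Suc j)))"
      using IH(1) a_Suc[of j] Suc.prems by auto
    have "dl = \<rho> * of_real (w j (a (Suc j)))"
      by (rule tendsto_unique[OF _ d(1) IH(2)]) simp
    then have "dr = \<rho> * of_real (w (Suc j) (a (Suc j)))"
      using jump Suc.prems unfolding d(3) \<phi> by (simp add: right_diff_distrib mult_ac)
    with d(2) \<phi> jump Suc.prems show ?case
      by (intro propagate) auto
  qed
  have "\<rho> \<noteq> 0"
  proof
    assume "\<rho> = 0"
    obtain x where x: "x \<in> {0..a (Suc N)}" "\<phi> x \<noteq> 0" using nz by blast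
    obtain j where "j \<le> N" "x \<in> {a j..a (Suc j)}" by (rule cover[OF x(1)])
    with all[of j] \<open>\<rho> = 0\<close> x(2) show False by auto
  qed
  moreover have "\<phi> (a (Suc N)) = \<rho> * of_real (u N (a (Suc N)))"
    using all[of N] a_Suc[of N] by auto
  ultimately show ?thesis using bc(2) fin by simp
qed

section \<open>The total angle at large energies\<close>

text \<open>Induction along the strings: each starts with the rescaled angle at most c / R below a
  multiple of pi and ends at distance at least c / R from the multiples, so that the next mass lifts
  it to within c / R of the following one.\<close>

lemma end_angle_between:
  "\<exists>C>0. \<forall>R>0. \<forall>n :: nat \<Rightarrow> int.
     (\<forall>j\<le>N. of_int (n j) * pi + C / R \<le> R * (a (Suc j) - a j) \<and>
            R * (a (Suc j) - a j) \<le> of_int (n j + 1) * pi - C / R) \<longrightarrow>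
     of_int (int N + (\<Sum>j\<le>N. n j)) * pi < end_angle (R\<^sup>2) N \<and>
     end_angle (R\<^sup>2) N < of_int (int N + (\<Sum>j\<le>N. n j) + 1) * pi"
proof -
  obtain Q where Q: "Q > 0" "\<And>j t. j \<le> N \<Longrightarrow> t \<in> {a j..a (Suc j)} \<Longrightarrow> \<bar>g j t\<bar> \<le> Q"
    using g_bound by blast
  define L where "L = a (Suc N)"
  \<comment> \<open>Exceeds \<open>4 / M j\<close> for all masses at once, as
    \<open>rescaled_angle_mass\<close> demands; the summand 1 makes it positive.\<close>
  define c where "c = 1 + (\<Sum>j\<in>{1..N}. 4 / M j)"
  have c: "4 / M j \<le> c" if "j \<in> {1..N}" for j
    using member_le_sum[of j "{1..N}" "\<lambda>j. 4 / M j"] that M_pos by (force simp: c_def)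
  have c0: "c > 0" unfolding c_def
    by (intro add_pos_nonneg sum_nonneg divide_nonneg_nonneg) (use M_pos in \<open>auto intro: less_imp_le\<close>)
  have L0: "L > 0" using a_mono[of 0 "Suc N"] a_0 by (simp add: L_def)
  \<comment> \<open>One \<open>c\<close> covers the deficit at the start of a string, the other is
    the margin needed at its end, and \<open>Q * L\<close> bounds the error from the
    potential.\<close>
  define C where "C = 2 * c + Q * L"
  have C0: "C > 0" using c0 L0 Q(1) by (simp add: C_def add_pos_pos)
  have main: "of_int (int N + (\<Sum>j\<le>N. n j)) * pi < end_angle (R\<^sup>2) N \<and>
     end_angle (R\<^sup>2) N < of_int (int N + (\<Sum>j\<le>N. n j) + 1) * pi"
    if R: "R > 0" and n: "\<And>j. j \<le> N \<Longrightarrow> of_int (n j) * pi + C / R \<le> R * (a (Suc j) - a j)"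
      "\<And>j. j \<le> N \<Longrightarrow> R * (a (Suc j) - a j) \<le> of_int (n j + 1) * pi - C / R" for R and n :: "nat \<Rightarrow> int"
  proof -
    \<comment> \<open>The multiple of pi just above the angle, or equal to it, on entering string
      \<open>j\<close>: \<open>n i\<close> for each earlier string and one more for each mass
      passed.\<close>
    define k where "k j = int j + (\<Sum>i<j. n i)" for j
    have k_Suc: "k (Suc j) = k j + n j + 1" for j by (simp add: k_def)
    have seg: "of_int (k j + n j) * pi + c / R \<le> rescaled_angle R (end_angle (R\<^sup>2) j) \<and>
        rescaled_angle R (end_angle (R\<^sup>2) j) \<le> of_int (k j + n j + 1) * pi - c / R"
      if j: "j \<le> N" and start: "of_int (k j) * pi - c / R \<le> rescaled_angle R (start_angle (R\<^sup>2) j)"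
        "rescaled_angle R (start_angle (R\<^sup>2) j) \<le> of_int (k j) * pi" for j
    proof -
      define l where "l = a (Suc j) - a j"
      have "l \<le> L" unfolding l_def L_def
        using a_mono_le[of "Suc j" "Suc N"] a_mono_le[of 0 j] a_0 j by simp
      then have "Q / R * l \<le> Q / R * L" using Q(1) R by (intro mult_left_mono) auto
      then have "Q / R * l \<le> C / R - 2 * (c / R)"
        by (simp add: C_def add_divide_distrib)
      moreover have "\<bar>rescaled_angle R (end_angle (R\<^sup>2) j) - rescaled_angle R (start_angle (R\<^sup>2) j) - R * l\<bar> \<le> Q / R * l"
        using rescaled_angle_string[OF less_imp_le[OF a_Suc[OF j]] R angle(1)[OF j], of Q] Q(2)[OF j] angle(2)[OF j]
        by (simp add: end_angle_def l_def)
      moreover have "of_int (n j) * pi + C / R \<le> R * l" "R * l \<le> of_int (n j) * pi + pi - C / R"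
        using n[OF j] by (simp_all add: l_def algebra_simps)
      ultimately show ?thesis using start unfolding abs_le_iff of_int_add of_int_1 distrib_right by linarith
    qed
    have start: "j \<le> N \<Longrightarrow> of_int (k j) * pi - c / R \<le> rescaled_angle R (start_angle (R\<^sup>2) j) \<and>
        rescaled_angle R (start_angle (R\<^sup>2) j) \<le> of_int (k j) * pi" for j
    proof (induction j)
      case 0
      then show ?case using c0 R rescaled_angle_npi[of R 0] by (simp add: k_def)
    next
      case (Suc j)
      then have j: "j \<le> N" "Suc j \<in> {1..N}" by auto
      have s: "of_int (k j + n j) * pi + c / R \<le> rescaled_angle R (end_angle (R\<^sup>2) j)"
        "rescaled_angle R (end_angle (R\<^sup>2) j) \<le> of_int (k j + n j + 1) * pi - c / R"
        using seg[OF j(1)] Suc by auto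
      show ?case
        using rescaled_angle_mass[OF M_pos[OF j(2)] R mass_angle(1)[of j "R\<^sup>2"], of "k j + n j" c] s c[OF j(2)]
        unfolding mass_angle(2,3) k_Suc by blast
    qed
    have kN: "k N + n N = int N + (\<Sum>j\<le>N. n j)"
      by (simp add: k_def flip: lessThan_Suc_atMost)
    have "c / R > 0" using c0 R by simp
    with seg[OF order_refl] start[OF order_refl]
    have "of_int (k N + n N) * pi < rescaled_angle R (end_angle (R\<^sup>2) N)"
      "rescaled_angle R (end_angle (R\<^sup>2) N) < of_int (k N + n N + 1) * pi" by linarith+
    then show ?thesis by (simp only: rescaled_angle_npi_less[OF R] kN)
  qed
  show ?thesis
    by (intro exI[of _ C] conjI[OF C0] allI impI main) auto
qed

end

section \<open>Counting and matching\<close>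

text \<open>If \<open>n = h k\<close> with \<open>k < n\<close>, induction gives
  \<open>h k = k\<close>. If \<open>k > n\<close>, then \<open>h n < n\<close> is fixed by
  \<open>h\<close> by induction, contradicting strict growth from \<open>h n\<close> to
  \<open>n\<close>.\<close>

lemma strict_mono_onto_identity:
  fixes h :: "nat \<Rightarrow> nat"
  assumes "strict_mono_on {1..} h" "h ` {1..} = {1..}" "n \<ge> 1"
  shows "h n = n"
  using assms(3)
proof (induction n rule: less_induct)
  case (less n)
  have "n \<in> h ` {1..}" using assms(2) less.prems by auto
  then obtain k where k: "k \<ge> 1" "h k = n" by auto
  have "h n \<ge> 1" using assms(2) less.prems by auto
  consider "k < n" | "k = n" | "n < k" by linarith
  then show ?case
  proof cases
    case 1
    then show ?thesis using less.IH[of k] k by simp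
  next
    case 3
    then have "h n < n" using strict_mono_onD[OF assms(1), of n k] k less.prems by simp
    then have "h (h n) = h n" using less.IH \<open>h n \<ge> 1\<close> by blast
    then have "h n = n"
      using strict_mono_onD[OF assms(1), of "h n" n] \<open>h n \<ge> 1\<close> less.prems \<open>h n < n\<close> by auto
    then show ?thesis .
  qed (use k in simp)
qed

text \<open>Elements are ordered by \<open>f\<close> with ties broken by \<open>g\<close>, and the
  rank counts the elements up to \<open>x\<close>. Coinciding frequencies of different strings thus
  receive different ranks. The two inequalities relate ranks to the counting function of
  \<open>f\<close>.\<close>

lemma ranking:
  fixes f :: "'a \<Rightarrow> real" and g :: "'a \<Rightarrow> 'b :: linorder"
  assumes inj: "\<And>x y. x \<in> X \<Longrightarrow> y \<in> X \<Longrightarrow> f x = f y \<Longrightarrow> g x = g y \<Longrightarrow> x = y"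
    and fin: "\<And>r. finite {x \<in> X. f x \<le> r}" and inf: "infinite X"
  shows "\<exists>rk. bij_betw rk X {1::nat..} \<and>
    (\<forall>x\<in>X. \<forall>r. (f x \<le> r \<longrightarrow> rk x \<le> card {y \<in> X. f y \<le> r}) \<and>
               (r < f x \<longrightarrow> card {y \<in> X. f y \<le> r} < rk x))"
proof -
  define I where "I x = {y \<in> X. f y < f x \<or> f y = f x \<and> g y \<le> g x}" for x
  define rk where "rk x = card (I x)" for x
  have sub: "I x \<subseteq> {y \<in> X. f y \<le> f x}" for x by (auto simp: I_def)
  have finI: "finite (I x)" for x by (rule finite_subset[OF sub fin])
  have less: "rk x < rk y" if "x \<in> X" "y \<in> X" "x \<noteq> y" "f x < f y \<or> f x = f y \<and> g x \<le> g y" for x y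
    unfolding rk_def
  proof (rule psubset_card_mono[OF finI])
    have "I x \<subseteq> I y" using that(4) by (auto simp: I_def)
    moreover have "y \<in> I y" using that(2) by (simp add: I_def)
    moreover have "y \<notin> I x"
    proof
      assume "y \<in> I x"
      then have "f x = f y" "g x = g y" using that(4) by (auto simp: I_def)
      then show False using inj that(1-3) by blast
    qed
    ultimately show "I x \<subset> I y" by blast
  qed
  have injr: "inj_on rk X"
    by (rule inj_onI) (metis less less_irrefl linorder_less_linear linorder_le_cases)
  have upper: "rk x \<le> card {y \<in> X. f y \<le> r}" if "f x \<le> r" for x r
    unfolding rk_def by (rule card_mono[OF fin]) (use that in \<open>auto simp: I_def\<close>)
  have lower: "card {y \<in> X. f y \<le> r} < rk x" if "x \<in> X" "r < f x" for x r
    unfolding rk_def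
    by (rule psubset_card_mono[OF finI]) (use that in \<open>auto simp: I_def\<close>)
  have pos: "rk x \<ge> 1" if "x \<in> X" for x
  proof -
    have "x \<in> I x" using that by (simp add: I_def)
    then have "card (I x) > 0" using finI[of x] by (simp add: card_gt_0_iff) blast
    then show ?thesis by (simp add: rk_def)
  qed
  have "k \<in> rk ` X" if "k \<ge> 1" for k
  proof -
    obtain T where T: "T \<subseteq> X" "finite T" "card T = k"
      using infinite_arbitrarily_large[OF inf] by blast
    \<comment> \<open>An initial segment with at least \<open>k\<close> elements: \<open>rk\<close>
      maps it injectively into \<open>{1..card S}\<close>, hence onto it, and so attains
      \<open>k\<close>.\<close>
    define S where "S = {x \<in> X. f x \<le> Max (f ` T)}"
    have "finite S" unfolding S_def by (rule fin)
    have "T \<subseteq> S" using T by (auto simp: S_def)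
    then have "k \<le> card S" using T \<open>finite S\<close> card_mono by blast
    have "rk ` S \<subseteq> {1..card S}" using upper pos by (auto simp: S_def)
    moreover have "card (rk ` S) = card {1..card S}"
      using card_image[OF inj_on_subset[OF injr, of S]] by (simp add: S_def)
    ultimately have "rk ` S = {1..card S}" by (intro card_subset_eq) auto
    then have "k \<in> rk ` S" using that \<open>k \<le> card S\<close> by simp
    then show ?thesis by (auto simp: S_def)
  qed
  then have "rk ` X = {1..}" using pos by auto
  then have "bij_betw rk X {1..}" using injr by (simp add: bij_betw_def)
  then show ?thesis using upper lower by blast
qed

section \<open>Radii that keep every string away from the multiples of pi\<close>

text \<open>The hypothesis of \<open>end_angle_between\<close> for lengths \<open>l j\<close>, with
  the floors as the integers \<open>n j\<close>.\<close>

definition good_radius :: "nat \<Rightarrow> (nat \<Rightarrow> real) \<Rightarrow> real \<Rightarrow> real \<Rightarrow> bool" where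
  "good_radius N l C R \<longleftrightarrow> (\<forall>j\<le>N. of_int \<lfloor>R * l j / pi\<rfloor> * pi + C / R \<le> R * l j \<and>
     R * l j \<le> of_int (\<lfloor>R * l j / pi\<rfloor> + 1) * pi - C / R)"

text \<open>
  Among \<open>N + 2\<close> points spaced by a large multiple of \<open>1 / x\<close>, each of the \<open>N + 1\<close> lengths spoils at
  most one.
\<close>

lemma good_radius_exists:
  fixes l :: "nat \<Rightarrow> real"
  assumes l: "\<And>j. j \<le> N \<Longrightarrow> 0 < l j" and C: "C > 0"
  shows "\<exists>B>0. \<exists>x0>0. \<forall>x\<ge>x0. \<exists>R\<ge>x. R \<le> x + B / x \<and> good_radius N l C R"
proof -
  define \<alpha> where "\<alpha> = Min (l ` {..N})"
  define \<beta> where "\<beta> = Max (l ` {..N})"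
  have \<alpha>: "\<alpha> > 0" unfolding \<alpha>_def using l by (subst Min_gr_iff) auto
  have l\<alpha>: "\<alpha> \<le> l j" "l j \<le> \<beta>" if "j \<le> N" for j
    using that unfolding \<alpha>_def \<beta>_def by auto
  \<comment> \<open>One step of length \<open>h / x\<close> moves \<open>R * l j\<close> by at least
    \<open>4 * C / x\<close>, more than the width \<open>2 * C / x\<close> of a forbidden
    window.\<close>
  define h where "h = 4 * C / \<alpha>"
  have h: "h > 0" using C \<alpha> by (simp add: h_def)
  define B where "B = real (N + 1) * h"
  have B: "B > 0" using h by (simp add: B_def)
  \<comment> \<open>Beyond \<open>x0\<close> all the test points together move
    \<open>R * l j\<close> by less than \<open>pi - 2 * C / x\<close>, so they cannot meet the
    windows of two different multiples of pi.\<close>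
  define x0 where "x0 = (B * \<beta> + 2 * C) / pi + 1"
  have \<beta>: "\<beta> > 0" using l\<alpha>[of 0] \<alpha> by simp
  have x0: "x0 > 0" using B \<beta> C by (simp add: x0_def add_pos_pos)
  show ?thesis
  proof (rule exI[of _ B], rule conjI[OF B], rule exI[of _ x0], rule conjI[OF x0], intro allI impI)
    fix x assume x: "x \<ge> x0"
    then have xpos: "x > 0" using x0 by simp
    have big: "(B * \<beta> + 2 * C) / x < pi"
    proof -
      have "(B * \<beta> + 2 * C) / pi < x" using x by (simp add: x0_def)
      then show ?thesis using xpos by (simp add: field_simps)
    qed
    define R where "R i = x + real i * (h / x)" for i :: nat
    have Rx: "R i \<ge> x" for i using h xpos by (simp add: R_def)
    show "\<exists>R\<ge>x. R \<le> x + B / x \<and> good_radius N l C R"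
    proof (rule ccontr)
      assume none: "\<not> ?thesis"
      have "\<exists>j\<le>N. \<exists>m::int. \<bar>R i * l j - of_int m * pi\<bar> < C / x" if i: "i \<in> {..Suc N}" for i
      proof -
        have "real i * (h / x) \<le> real (N + 1) * (h / x)"
          using i h xpos by (intro mult_right_mono) auto
        then have "R i \<le> x + B / x" by (simp add: R_def B_def)
        with none Rx[of i] have "\<not> good_radius N l C (R i)" by blast
        then obtain j where j: "j \<le> N" and bad: "\<not> (of_int \<lfloor>R i * l j / pi\<rfloor> * pi + C / R i \<le> R i * l j \<and>
            R i * l j \<le> of_int (\<lfloor>R i * l j / pi\<rfloor> + 1) * pi - C / R i)"
          unfolding good_radius_def by blast
        have "C / R i \<le> C / x" using Rx[of i] xpos C by (intro divide_left_mono) auto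
        moreover have "of_int \<lfloor>R i * l j / pi\<rfloor> * pi \<le> R i * l j"
          using of_int_floor_le[of "R i * l j / pi"] by (simp only: pos_le_divide_eq[OF pi_gt_zero])
        moreover have "R i * l j < (of_int \<lfloor>R i * l j / pi\<rfloor> + 1) * pi"
          using real_of_int_floor_add_one_gt[of "R i * l j / pi"] by (simp only: pos_divide_less_eq[OF pi_gt_zero])
        ultimately have "\<bar>R i * l j - of_int \<lfloor>R i * l j / pi\<rfloor> * pi\<bar> < C / x \<or>
            \<bar>R i * l j - of_int (\<lfloor>R i * l j / pi\<rfloor> + 1) * pi\<bar> < C / x"
          using bad by (auto simp: abs_less_iff algebra_simps)
        then show ?thesis using j by blast
      qed
      then obtain J where J: "\<And>i. i \<in> {..Suc N} \<Longrightarrow> J i \<le> N \<and> (\<exists>m::int. \<bar>R i * l (J i) - of_int m * pi\<bar> < C / x)"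
        by metis
      have False if i: "i < i'" "i' \<le> Suc N" "J i = J i'" for i i'
      proof -
        define j where "j = J i"
        have j: "j \<le> N" using J[of i] i by (simp add: j_def)
        obtain m m' :: int where m: "\<bar>R i * l j - of_int m * pi\<bar> < C / x" "\<bar>R i' * l j - of_int m' * pi\<bar> < C / x"
          using J[of i] J[of i'] i by (auto simp: j_def)
        have "R i' * l j - R i * l j = real (i' - i) * (h / x) * l j"
          using i(1) by (simp add: R_def of_nat_diff algebra_simps)
        moreover have "1 * (h / x) * \<alpha> \<le> real (i' - i) * (h / x) * l j"
          using i(1) h xpos \<alpha> l\<alpha>[OF j] by (intro mult_mono) auto
        moreover have "real (i' - i) * (h / x) * l j \<le> real (N + 1) * (h / x) * \<beta>"
          using i h xpos \<alpha> l\<alpha>[OF j] by (intro mult_mono) auto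
        moreover have "1 * (h / x) * \<alpha> = 4 * (C / x)" using \<alpha> by (simp add: h_def)
        moreover have "real (N + 1) * (h / x) * \<beta> = B * \<beta> / x" by (simp add: B_def)
        moreover have "B * \<beta> / x + 2 * (C / x) < pi" using big by (simp add: add_divide_distrib)
        moreover have "C / x > 0" using C xpos by simp
        \<comment> \<open>Two test points spoiled by the same length would belong to multiples of pi
          whose indices differ by an integer strictly between 0 and 1.\<close>
        ultimately have diff: "0 < (of_int m' - of_int m) * pi" "(of_int m' - of_int m) * pi < pi"
          using m unfolding abs_less_iff left_diff_distrib by linarith+
        then have "0 < real_of_int (m' - m)" "real_of_int (m' - m) < 1" by (auto simp: zero_less_mult_iff)
        then show False by (simp only: of_int_0_less_iff of_int_less_1_iff)
      qed
      then have "inj_on J {..Suc N}"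
        by (intro inj_onI) (metis atMost_iff linorder_less_linear)
      moreover have "J ` {..Suc N} \<subseteq> {..N}" using J by auto
      ultimately have "card {..Suc N} \<le> card {..N}" by (intro card_inj_on_le) auto
      then show False by simp
    qed
  qed
qed

section \<open>Counting the string frequencies and exchanging indices\<close>

text \<open>Identifies the sum of floors in the eigenvalue count with the counting function of the
  family pi m / l_j: string \<open>j\<close> contributes the \<open>m\<close> from 1 to its
  floor.\<close>

lemma card_multiples_le:
  fixes l :: "nat \<Rightarrow> real"
  assumes l: "\<And>j. j \<le> N \<Longrightarrow> 0 < l j" and R: "R \<ge> 0"
  shows "finite {x \<in> {0..N} \<times> {1::nat..}. pi * real (snd x) / l (fst x) \<le> R}"
    and "int (card {x \<in> {0..N} \<times> {1::nat..}. pi * real (snd x) / l (fst x) \<le> R}) = (\<Sum>j\<le>N. \<lfloor>R * l j / pi\<rfloor>)"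
proof -
  have fl: "\<lfloor>R * l j / pi\<rfloor> \<ge> 0" if "j \<le> N" for j
    using l[OF that] R by simp
  have iff: "pi * real m / l j \<le> R \<longleftrightarrow> m \<le> nat \<lfloor>R * l j / pi\<rfloor>" if "j \<le> N" for j m
  proof -
    have "pi * real m / l j \<le> R \<longleftrightarrow> real m \<le> R * l j / pi"
      using l[OF that] by (simp add: field_simps)
    also have "\<dots> \<longleftrightarrow> int m \<le> \<lfloor>R * l j / pi\<rfloor>" by (simp add: le_floor_iff)
    finally show ?thesis using fl[OF that] by (simp add: le_nat_iff)
  qed
  have eq: "{x \<in> {0..N} \<times> {1::nat..}. pi * real (snd x) / l (fst x) \<le> R}
      = (SIGMA j:{..N}. {1..nat \<lfloor>R * l j / pi\<rfloor>})"
    using iff by auto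
  show "finite {x \<in> {0..N} \<times> {1::nat..}. pi * real (snd x) / l (fst x) \<le> R}"
    unfolding eq by auto
  show "int (card {x \<in> {0..N} \<times> {1::nat..}. pi * real (snd x) / l (fst x) \<le> R}) = (\<Sum>j\<le>N. \<lfloor>R * l j / pi\<rfloor>)"
    unfolding eq using fl by (subst card_SigmaI) auto
qed

text \<open>Equal cardinalities leave \<open>D - D0\<close> and \<open>D0 - D\<close> equinumerous.
  Redirecting the values of \<tau> in the former to the latter changes the removed set from
  \<open>D0\<close> to \<open>D\<close> and touches no other value.\<close>

lemma bij_betw_exchange:
  assumes \<tau>: "bij_betw \<tau> A (K - D0)" and "D0 \<subseteq> K" "D \<subseteq> K" "finite D0" "finite D" "card D = card D0"
  shows "\<exists>\<sigma>. bij_betw \<sigma> A (K - D) \<and> (\<forall>x\<in>A. \<tau> x \<notin> D \<longrightarrow> \<sigma> x = \<tau> x)"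
proof -
  have "card (D - D0) = card (D0 - D)"
    using assms(4,5,6) by (metis card_Diff_subset_Int Int_commute finite_Int)
  then obtain h where h: "bij_betw h (D - D0) (D0 - D)"
    using finite_same_card_bij[of "D - D0" "D0 - D"] assms(4,5) by auto
  define \<pi> where "\<pi> y = (if y \<in> D then h y else y)" for y
  have "bij_betw \<pi> (D - D0) (D0 - D)"
    by (rule bij_betw_cong[THEN iffD1, OF _ h]) (simp add: \<pi>_def)
  moreover have "bij_betw \<pi> (K - D0 - D) (K - D0 - D)"
    by (rule bij_betw_cong[THEN iffD1, OF _ bij_betw_id]) (simp add: \<pi>_def)
  ultimately have "bij_betw \<pi> ((D - D0) \<union> (K - D0 - D)) ((D0 - D) \<union> (K - D0 - D))"
    by (rule bij_betw_combine) auto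
  moreover have "(D - D0) \<union> (K - D0 - D) = K - D0" "(D0 - D) \<union> (K - D0 - D) = K - D"
    using assms(2,3) by auto
  ultimately have "bij_betw \<pi> (K - D0) (K - D)" by simp
  then have "bij_betw (\<pi> \<circ> \<tau>) A (K - D)" using \<tau> bij_betw_trans by blast
  then show ?thesis by (intro exI[of _ "\<pi> \<circ> \<tau>"]) (auto simp: \<pi>_def)
qed

text \<open>The \<open>2 * N\<close> frequencies with index in \<open>{- N..N}\<close> are the surplus over the Dirichlet frequencies.\<close>

lemma bij_betw_signed:
  fixes rk :: "nat \<times> nat \<Rightarrow> nat"
  assumes rk: "bij_betw rk ({0..N} \<times> {1..}) {1..}"
  defines "\<tau> \<equiv> \<lambda>(j, m). sgn m * int (N + rk (j, nat \<bar>m\<bar>))"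
  shows "bij_betw \<tau> ({0..N} \<times> \<K>) (\<K> - ({- int N..int N} - {0}))"
proof -
  note inj = bij_betw_imp_inj_on[OF rk] and surj = bij_betw_imp_surj_on[OF rk]
  have pos: "rk (j, nat \<bar>m\<bar>) \<ge> 1" if "j \<le> N" "m \<noteq> 0" for j m
  proof -
    have "(j, nat \<bar>m\<bar>) \<in> {0..N} \<times> {1..}" using that by auto
    then show ?thesis using surj by auto
  qed
  \<comment> \<open>Since ranks start at 1, a value of \<tau> has modulus above \<open>N\<close> and
    keeps the sign of \<open>m\<close>; modulus and sign can then be recovered separately.\<close>
  have abs\<tau>: "\<bar>\<tau> (j, m)\<bar> = int (N + rk (j, nat \<bar>m\<bar>))" "sgn (\<tau> (j, m)) = sgn m"
    if "j \<le> N" "m \<noteq> 0" for j m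
    using pos[OF that] that by (auto simp: \<tau>_def abs_mult sgn_mult)
  show ?thesis
  proof (rule bij_betw_imageI)
    show "inj_on \<tau> ({0..N} \<times> \<K>)"
    proof (rule inj_onI, clarify)
      fix j m j' m' assume *: "j \<in> {0..N}" "m \<in> \<K>" "j' \<in> {0..N}" "m' \<in> \<K>" "\<tau> (j, m) = \<tau> (j', m')"
      then have jm: "j \<le> N" "m \<noteq> 0" "j' \<le> N" "m' \<noteq> 0" by (auto simp: \<K>_def)
      have "rk (j, nat \<bar>m\<bar>) = rk (j', nat \<bar>m'\<bar>)"
        using abs\<tau>(1)[OF jm(1,2)] abs\<tau>(1)[OF jm(3,4)] *(5) by simp
      then have "(j, nat \<bar>m\<bar>) = (j', nat \<bar>m'\<bar>)"
        by (rule inj_onD[OF inj]) (use jm in auto)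
      moreover have "sgn m = sgn m'"
        using abs\<tau>(2)[OF jm(1,2)] abs\<tau>(2)[OF jm(3,4)] *(5) by simp
      ultimately show "j = j' \<and> m = m'" by (metis Pair_inject eq_nat_nat_iff abs_ge_zero sgn_mult_abs)
    qed
    show "\<tau> ` ({0..N} \<times> \<K>) = \<K> - ({- int N..int N} - {0})"
    proof (intro equalityI subsetI)
      fix z assume "z \<in> \<tau> ` ({0..N} \<times> \<K>)"
      then obtain j m where "z = \<tau> (j, m)" "j \<le> N" "m \<in> \<K>" by auto
      then have z: "z = \<tau> (j, m)" "j \<le> N" "m \<noteq> 0" by (auto simp: \<K>_def)
      then have "\<bar>z\<bar> > int N" using abs\<tau>(1)[OF z(2,3)] pos[OF z(2,3)] by simp
      then show "z \<in> \<K> - ({- int N..int N} - {0})" by (auto simp: \<K>_def)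
    next
      fix z assume "z \<in> \<K> - ({- int N..int N} - {0})"
      then have z: "\<bar>z\<bar> > int N" "z \<noteq> 0" by (auto simp: \<K>_def)
      then have "nat \<bar>z\<bar> - N \<in> rk ` ({0..N} \<times> {1..})" unfolding surj by auto
      then obtain j n where jn: "j \<le> N" "n \<ge> 1" "rk (j, n) = nat \<bar>z\<bar> - N" by auto
      have "\<tau> (j, sgn z * int n) = z"
      proof -
        have "sgn (sgn z * int n) = sgn z" "nat \<bar>sgn z * int n\<bar> = n"
          using jn(2) z(2) by (auto simp: sgn_mult abs_mult)
        then have "\<tau> (j, sgn z * int n) = sgn z * \<bar>z\<bar>" using z jn(3) by (simp add: \<tau>_def)
        then show ?thesis by (simp add: sgn_mult_abs)
      qed
      moreover have "(j, sgn z * int n) \<in> {0..N} \<times> \<K>" using jn z(2) by (auto simp: \<K>_def sgn_if)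
      ultimately show "z \<in> \<tau> ` ({0..N} \<times> \<K>)" by (metis image_eqI)
    qed
  qed
qed

section \<open>Matching eigenvalues with string frequencies\<close>

context string_with_masses
begin

lemma end_angle_less_iff: "end_angle \<mu> N < end_angle \<nu> N \<longleftrightarrow> \<mu> < \<nu>"
  using angle_mono(2)[of \<mu> \<nu> N] angle_mono(2)[of \<nu> \<mu> N] by (metis less_asym linorder_neqE order_refl)

text \<open>The angle at \<open>ev n\<close> is a positive multiple \<open>h n\<close> of pi, with
  \<open>h\<close> strictly increasing. Continuity of the angle makes every positive multiple occur,
  so \<open>h\<close> is onto and hence the identity.\<close>

lemma end_angle_eigenvalue:
  assumes ev: "lists_eigenvalues N a (a (Suc N)) M q ev" and n: "n \<ge> 1"
  shows "end_angle (ev n) N = real n * pi"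
proof -
  have mono: "strict_mono_on {1..} ev" and
    eigs: "eigenvalues N a (a (Suc N)) M q = (\<lambda>n. complex_of_real (ev n)) ` {1..}"
    using ev by (auto simp: lists_eigenvalues_def)
  have "\<exists>k. end_angle (ev n) N = real k * pi" if "n \<ge> 1" for n
  proof -
    have "complex_of_real (ev n) \<in> eigenvalues N a (a (Suc N)) M q" using that eigs by auto
    then obtain i :: int where i: "end_angle (ev n) N = of_int i * pi"
      using sin_zero_if_eigenvalue sin_zero_iff_int2 by blast
    moreover have "i > 0" using angle_pos(2)[of N "ev n"] i by (simp add: zero_less_mult_iff)
    ultimately show ?thesis by (intro exI[of _ "nat i"]) simp
  qed
  then obtain h where h: "\<And>n. n \<ge> 1 \<Longrightarrow> end_angle (ev n) N = real (h n) * pi" by metis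
  have h_mono: "strict_mono_on {1..} h"
  proof (rule strict_mono_onI)
    fix m n :: nat assume "m \<in> {1..}" "n \<in> {1..}" "m < n"
    then have "end_angle (ev m) N < end_angle (ev n) N"
      using strict_mono_onD[OF mono] end_angle_less_iff by blast
    then show "h m < h n" using h \<open>m \<in> _\<close> \<open>n \<in> _\<close> by simp
  qed
  \<comment> \<open>Provides the upper end for the intermediate value theorem: the angle at
    \<open>ev k\<close> is at least \<open>k * pi\<close>.\<close>
  have h_ge: "h n \<ge> n" if "n \<ge> 1" for n
    using that
  proof (induction n rule: nat_induct_at_least)
    case base
    have "end_angle (ev 1) N > 0" by (rule angle_pos) simp
    then show ?case using h[of 1] by (simp add: zero_less_mult_iff)
  next
    case (Suc n)
    then show ?case using strict_mono_onD[OF h_mono, of n "Suc n"] by simp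
  qed
  have "k \<in> h ` {1..}" if "k \<ge> 1" for k
  proof -
    obtain \<mu>0 where \<mu>0: "end_angle \<mu>0 N < pi" using end_angle_small by blast
    have "1 * pi \<le> real k * pi" using that by (intro mult_right_mono) auto
    then have 1: "end_angle \<mu>0 N < real k * pi" using \<mu>0 by linarith
    have 2: "real k * pi \<le> end_angle (ev k) N" using h[OF that] h_ge[OF that] by (simp add: mult_right_mono)
    have "\<mu>0 < ev k" using 1 2 end_angle_less_iff[of \<mu>0 "ev k"] by linarith
    then obtain \<mu> where \<mu>: "end_angle \<mu> N = real k * pi"
      using IVT'[of "\<lambda>\<mu>. end_angle \<mu> N" \<mu>0 "real k * pi" "ev k"] 1 2
        continuous_on_subset[OF angle_continuous(2)[OF order_refl]] by fastforce
    then have "sin (end_angle \<mu> N) = 0" using sin_npi[of k] by simp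
    then obtain n where n: "n \<ge> 1" "\<mu> = ev n" using eigenvalue_if_sin_zero[of \<mu>] eigs by auto
    then have "h n = k" using h[of n] \<mu> by simp
    then show ?thesis using n(1) by auto
  qed
  moreover have "h n \<ge> 1" if "n \<ge> 1" for n using h_ge[OF that] that by simp
  ultimately have "h ` {1..} = {1..}" by auto
  then have "h n = n" by (rule strict_mono_onto_identity[OF h_mono _ n])
  then show ?thesis using h[OF n] by simp
qed

text \<open>Good radii R' < f x \<le> R are taken close to \<open>f x\<close>. At most
  \<open>N + rk x - 1\<close> eigenvalues lie below R'^2 and at least \<open>N + rk x\<close> below
  R^2, so the one with index \<open>N + rk x\<close> lies between.\<close>

lemma sqrt_eigenvalue_near:
  assumes ev: "lists_eigenvalues N a (a (Suc N)) M q ev"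
  defines "f \<equiv> \<lambda>x. pi * real (snd x) / (a (Suc (fst x)) - a (fst x))"
  assumes lower: "\<And>x r. x \<in> {0..N} \<times> {1::nat..} \<Longrightarrow> r < f x \<Longrightarrow>
      card {y \<in> {0..N} \<times> {1..}. f y \<le> r} < rk x"
    and upper: "\<And>x r. x \<in> {0..N} \<times> {1::nat..} \<Longrightarrow> f x \<le> r \<Longrightarrow>
      rk x \<le> card {y \<in> {0..N} \<times> {1..}. f y \<le> r}"
  shows "\<exists>B>0. \<exists>b>0. \<forall>x \<in> {0..N} \<times> {1..}. b \<le> f x \<longrightarrow>
      0 < ev (N + rk x) \<and> \<bar>sqrt (ev (N + rk x)) - f x\<bar> \<le> B / f x"
proof -
  define l where "l j = a (Suc j) - a j" for j
  have l: "0 < l j" if "j \<le> N" for j using a_Suc[OF that] by (simp add: l_def)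
  obtain C where C: "C > 0" and between: "\<And>R (n :: nat \<Rightarrow> int). R > 0 \<Longrightarrow>
     (\<forall>j\<le>N. of_int (n j) * pi + C / R \<le> R * (a (Suc j) - a j) \<and>
            R * (a (Suc j) - a j) \<le> of_int (n j + 1) * pi - C / R) \<Longrightarrow>
     of_int (int N + (\<Sum>j\<le>N. n j)) * pi < end_angle (R\<^sup>2) N \<and>
     end_angle (R\<^sup>2) N < of_int (int N + (\<Sum>j\<le>N. n j) + 1) * pi"
    using end_angle_between by blast
  define nB where "nB R = card {y \<in> {0..N} \<times> {1..}. f y \<le> R}" for R
  have count: "real (N + nB R) * pi < end_angle (R\<^sup>2) N" "end_angle (R\<^sup>2) N < real (N + nB R + 1) * pi"
    if "R > 0" "good_radius N l C R" for R
  proof -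
    have "int (nB R) = (\<Sum>j\<le>N. \<lfloor>R * l j / pi\<rfloor>)"
      unfolding nB_def f_def l_def[symmetric] by (rule card_multiples_le(2)) (use l that in auto)
    moreover have "of_int (int N + (\<Sum>j\<le>N. \<lfloor>R * l j / pi\<rfloor>)) * pi < end_angle (R\<^sup>2) N \<and>
      end_angle (R\<^sup>2) N < of_int (int N + (\<Sum>j\<le>N. \<lfloor>R * l j / pi\<rfloor>) + 1) * pi"
      by (rule between[OF that(1)]) (use that(2) in \<open>simp add: good_radius_def l_def\<close>)
    moreover have "real (N + nB R) = of_int (int N + int (nB R))"
      "real (N + nB R + 1) = of_int (int N + int (nB R) + 1)" by simp_all
    ultimately show "real (N + nB R) * pi < end_angle (R\<^sup>2) N" "end_angle (R\<^sup>2) N < real (N + nB R + 1) * pi"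
      by metis+
  qed
  obtain B x0 where B: "B > 0" and x0: "x0 > 0"
    and good: "\<And>x. x \<ge> x0 \<Longrightarrow> \<exists>R\<ge>x. R \<le> x + B / x \<and> good_radius N l C R"
    using good_radius_exists[of N l C] l C by blast
  have main: "0 < ev (N + rk x) \<and> \<bar>sqrt (ev (N + rk x)) - f x\<bar> \<le> 3 * B / f x"
    if x: "x \<in> {0..N} \<times> {1..}" and big: "2 * x0 + 6 * B + 1 \<le> f x" for x
  proof -
    define b where "b = f x"
    have b: "b \<ge> 2 * x0" "b \<ge> 6 * B" "b \<ge> 1" using big B x0 by (auto simp: b_def)
    have "rk x \<ge> 1" using lower[OF x, of "f x - 1"] by simp
    then have ang: "end_angle (ev (N + rk x)) N = real (N + rk x) * pi"
      by (intro end_angle_eigenvalue[OF ev]) simp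
    obtain R where R: "R \<ge> b" "R \<le> b + B / b" "good_radius N l C R"
      using good[of b] b x0 by auto
    have "real (N + rk x) * pi \<le> real (N + nB R) * pi"
      using upper[OF x, of R] R(1) by (intro mult_right_mono) (auto simp: nB_def b_def)
    also have "\<dots> < end_angle (R\<^sup>2) N" using count(1)[OF _ R(3)] R(1) b by simp
    finally have ev_less: "ev (N + rk x) < R\<^sup>2" unfolding ang[symmetric] end_angle_less_iff .
    \<comment> \<open>A good radius above \<open>y\<close> exceeds it by at most
      \<open>B / y \<le> 2 * B / b\<close>, so the shift \<open>3 * B / b\<close> keeps it below
      \<open>b\<close>; the threshold on \<open>f x\<close> ensures that \<open>y\<close> is at
      least \<open>b / 2\<close> and \<open>x0\<close>.\<close>
    define y where "y = b - 3 * B / b"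
    have "3 * B / b \<le> b / 2"
    proof -
      have "6 * B \<le> b * b" using b mult_right_mono[of 1 b b] by linarith
      then show ?thesis using b by (simp add: field_simps)
    qed
    then have y: "y \<ge> b / 2" "y \<ge> x0" "y > 0" using b by (auto simp: y_def)
    obtain R' where R': "R' \<ge> y" "R' \<le> y + B / y" "good_radius N l C R'"
      using good[OF y(2)] by blast
    have "B / y \<le> B / (b / 2)" using y b B by (intro divide_left_mono) auto
    also have "\<dots> < 3 * B / b" using b B by (simp add: field_simps)
    finally have "R' < b" using R'(2) by (simp add: y_def)
    have "end_angle (R'\<^sup>2) N < real (N + nB R' + 1) * pi" using count(2)[OF _ R'(3)] R'(1) y by simp
    also have "\<dots> \<le> real (N + rk x) * pi"
      using lower[OF x, of R'] \<open>R' < b\<close> by (intro mult_right_mono) (auto simp: nB_def b_def)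
    finally have ev_gr: "R'\<^sup>2 < ev (N + rk x)" unfolding ang[symmetric] end_angle_less_iff .
    have "0 < R'\<^sup>2" using R'(1) y by simp
    then have pos: "0 < ev (N + rk x)" using ev_gr by linarith
    have "sqrt (ev (N + rk x)) < R" using ev_less R(1) b by (intro real_less_lsqrt) auto
    moreover have "R' < sqrt (ev (N + rk x))" using ev_gr by (rule real_less_rsqrt)
    moreover have "B / b \<le> 3 * B / b" using B b by (intro divide_right_mono) auto
    ultimately have "\<bar>sqrt (ev (N + rk x)) - b\<bar> \<le> 3 * B / b"
      using R(2) R'(1) by (simp add: y_def abs_le_iff)
    with pos show ?thesis by (simp add: b_def)
  qed
  show ?thesis
  proof (intro exI conjI ballI impI)
    show "3 * B > 0" "2 * x0 + 6 * B + 1 > 0" using B x0 by auto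
  qed (use main in auto)
qed

end

section \<open>Asymptotics of the eigenfrequencies\<close>

lemma Ck_on_imp_continuous_on: "Ck_on k S f \<Longrightarrow> continuous_on S f"
proof -
  assume "Ck_on k S f"
  then obtain D where D: "\<forall>x\<in>S. D 0 x = f x"
    "\<forall>i<k. \<forall>x\<in>S. (D i has_real_derivative D (Suc i) x) (at x within S)" "continuous_on S (D k)"
    unfolding Ck_on_def by blast
  have "continuous_on S (D 0)"
  proof (cases k)
    case (Suc k')
    then show ?thesis using D(2) by (intro DERIV_continuous_on[of S "D 0" "D 1"]) auto
  qed (use D(3) in simp)
  then show ?thesis by (rule continuous_on_eq) (use D(1) in auto)
qed

lemma eigenfrequency_of_positive:
  assumes "0 < ev n" "n \<ge> 1" "m \<noteq> 0"
  shows "eigenfrequency ev (sgn m * int n) = of_int (sgn m) * of_real (sqrt (ev n))"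
proof -
  have "nat \<bar>sgn m * int n\<bar> = n" "sgn (sgn m * int n) = sgn m"
    using assms(2,3) by (auto simp: abs_mult sgn_mult)
  then show ?thesis using assms(1) by (simp add: eigenfrequency_def Let_def)
qed

text \<open>\<Lambda> is a family, so \<open>D\<close> and \<sigma> concern indices rather than
  values and a double 0 counts twice. The cofinite filter on the integers covers both directions of
  \<open>m\<close>.\<close>

theorem theorem4:
  fixes N :: nat and a M :: "nat \<Rightarrow> real" and L :: real and q :: "real \<Rightarrow> real"
    and ev :: "nat \<Rightarrow> real" and D :: "int set"
  assumes "loaded_string N a L M q"
    and "lists_eigenvalues N a L M q ev"
    and "D \<subseteq> \<K>" and "finite D" and "card D = 2 * N"
  shows "\<exists>\<sigma> :: nat \<times> int \<Rightarrow> int.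
           bij_betw \<sigma> ({0..N} \<times> \<K>) (\<K> - D) \<and>
           (\<forall>j\<in>{0..N}.
              (\<lambda>m. cmod (eigenfrequency ev (\<sigma> (j, m))
                         - complex_of_real (pi * real_of_int m / (a (Suc j) - a j))))
              \<in> O[cofinite](\<lambda>m. 1 / \<bar>real_of_int m\<bar>))"
proof -
  have string: "a 0 = 0" "a (Suc N) = L" "\<And>j. j \<le> N \<Longrightarrow> a j < a (Suc j)" "\<And>j. j \<in> {1..N} \<Longrightarrow> 0 < M j"
    and pot: "\<forall>j\<le>N. \<exists>g. Ck_on (j - 2) {a j..a (Suc j)} g \<and> (\<forall>x\<in>{a j<..<a (Suc j)}. g x = q x)"
    using assms(1) unfolding loaded_string_def by blast+
  obtain g where g: "\<forall>j\<le>N. Ck_on (j - 2) {a j..a (Suc j)} (g j) \<and> (\<forall>x\<in>{a j<..<a (Suc j)}. g j x = q x)"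
    using pot by metis
  interpret string_with_masses N a M q g
    by unfold_locales (use string g Ck_on_imp_continuous_on in blast)+
  define X where "X = {0..N} \<times> {1::nat..}"
  define f where "f x = pi * real (snd x) / (a (Suc (fst x)) - a (fst x))" for x :: "nat \<times> nat"
  have l: "0 < a (Suc j) - a j" if "j \<le> N" for j using string(3)[OF that] by simp
  have "\<exists>rk. bij_betw rk X {1::nat..} \<and>
    (\<forall>x\<in>X. \<forall>r. (f x \<le> r \<longrightarrow> rk x \<le> card {y \<in> X. f y \<le> r}) \<and>
               (r < f x \<longrightarrow> card {y \<in> X. f y \<le> r} < rk x))"
  proof (rule ranking[of X f fst])
    fix x y assume "x \<in> X" "y \<in> X" "f x = f y" "fst x = fst y"
    then show "x = y" using l[of "fst x"] by (auto simp: X_def f_def prod_eq_iff)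
  next
    fix r
    \<comment> \<open>The count is available for nonnegative radii; \<open>max r 0\<close> reduces
      the general case to it.\<close>
    have "finite {x \<in> X. f x \<le> max r 0}"
      unfolding X_def f_def by (rule card_multiples_le(1)[of N "\<lambda>j. a (Suc j) - a j"]) (use l in auto)
    then show "finite {x \<in> X. f x \<le> r}" by (rule rev_finite_subset) auto
  next
    have "snd ` X = {1..}" by (force simp: X_def)
    then show "infinite X" using infinite_Ici[of "1::nat"] finite_imageI by metis
  qed
  then obtain rk where rk: "bij_betw rk X {1::nat..}"
    and rk_le: "\<And>x r. x \<in> X \<Longrightarrow> f x \<le> r \<Longrightarrow> rk x \<le> card {y \<in> X. f y \<le> r}"
    and rk_gr: "\<And>x r. x \<in> X \<Longrightarrow> r < f x \<Longrightarrow> card {y \<in> X. f y \<le> r} < rk x" by blast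
  obtain B b where B: "B > 0" and b: "b > 0" and near: "\<And>x. x \<in> X \<Longrightarrow> b \<le> f x \<Longrightarrow>
      0 < ev (N + rk x) \<and> \<bar>sqrt (ev (N + rk x)) - f x\<bar> \<le> B / f x"
    using sqrt_eigenvalue_near[of ev rk] assms(2) rk_le rk_gr
    unfolding X_def f_def string(2) by blast
  \<comment> \<open>The string frequency of rank \<open>rk\<close> is matched with the
    eigenfrequency of index \<open>N + rk\<close>, extended oddly to negative \<open>m\<close>; this
    omits exactly the indices in \<open>D0\<close>.\<close>
  define \<tau> where "\<tau> = (\<lambda>(j, m). sgn m * int (N + rk (j, nat \<bar>m\<bar>)))"
  define D0 where "D0 = {- int N..int N} - {0}"
  have \<tau>: "bij_betw \<tau> ({0..N} \<times> \<K>) (\<K> - D0)"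
    unfolding \<tau>_def D0_def by (rule bij_betw_signed) (use rk in \<open>simp add: X_def\<close>)
  have "card D0 = 2 * N" by (simp add: D0_def card_Diff_singleton)
  then have "\<exists>\<sigma>. bij_betw \<sigma> ({0..N} \<times> \<K>) (\<K> - D) \<and>
      (\<forall>x\<in>{0..N} \<times> \<K>. \<tau> x \<notin> D \<longrightarrow> \<sigma> x = \<tau> x)"
    by (intro bij_betw_exchange[OF \<tau>]) (use assms(3-5) in \<open>auto simp: D0_def \<K>_def\<close>)
  then obtain \<sigma> where \<sigma>: "bij_betw \<sigma> ({0..N} \<times> \<K>) (\<K> - D)"
    and \<sigma>\<tau>: "\<And>x. x \<in> {0..N} \<times> \<K> \<Longrightarrow> \<tau> x \<notin> D \<Longrightarrow> \<sigma> x = \<tau> x"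
    by blast
  have "(\<lambda>m. cmod (eigenfrequency ev (\<sigma> (j, m))
          - complex_of_real (pi * real_of_int m / (a (Suc j) - a j))))
        \<in> O[cofinite](\<lambda>m. 1 / \<bar>real_of_int m\<bar>)" if "j \<in> {0..N}" for j
  proof (rule bigoI[where c = "B * (a (Suc j) - a j) / pi"])
    have j: "j \<le> N" using that by simp
    define l where "l = a (Suc j) - a j"
    have lpos: "l > 0" using string(3)[OF j] by (simp add: l_def)
    \<comment> \<open>Injectivity of \<tau> leaves finitely many \<open>m\<close> where \<sigma> may
      differ from \<tau>; they, 0 and the \<open>m\<close> with frequency below \<open>b\<close> are
      excluded.\<close>
    have "finite {m \<in> \<K>. \<tau> (j, m) \<in> D}"
    proof (rule finite_imageD)
      show "inj_on (\<lambda>m. \<tau> (j, m)) {m \<in> \<K>. \<tau> (j, m) \<in> D}"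
        using bij_betw_imp_inj_on[OF \<tau>] that by (auto simp: inj_on_def)
      show "finite ((\<lambda>m. \<tau> (j, m)) ` {m \<in> \<K>. \<tau> (j, m) \<in> D})"
        by (rule finite_subset[OF _ assms(4)]) auto
    qed
    moreover have "finite {m :: int. \<bar>m\<bar> \<le> \<lceil>b * l / pi\<rceil>}"
      by (rule finite_subset[of _ "{- \<lceil>b * l / pi\<rceil>..\<lceil>b * l / pi\<rceil>}"]) auto
    ultimately have "finite ({m \<in> \<K>. \<tau> (j, m) \<in> D} \<union> {m. \<bar>m\<bar> \<le> \<lceil>b * l / pi\<rceil>} \<union> {0})" by blast
    then have "\<forall>\<^sub>F m in cofinite. m \<notin> {m \<in> \<K>. \<tau> (j, m) \<in> D} \<union> {m. \<bar>m\<bar> \<le> \<lceil>b * l / pi\<rceil>} \<union> {0}"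
      by (simp add: eventually_cofinite)
    then show "\<forall>\<^sub>F m in cofinite. norm (cmod (eigenfrequency ev (\<sigma> (j, m))
          - complex_of_real (pi * real_of_int m / (a (Suc j) - a j))))
        \<le> B * (a (Suc j) - a j) / pi * norm (1 / \<bar>real_of_int m\<bar>)"
    proof (rule eventually_mono)
      fix m :: int
      assume "m \<notin> {m \<in> \<K>. \<tau> (j, m) \<in> D} \<union> {m. \<bar>m\<bar> \<le> \<lceil>b * l / pi\<rceil>} \<union> {0}"
      then have m: "m \<noteq> 0" "\<tau> (j, m) \<notin> D" "\<lceil>b * l / pi\<rceil> < \<bar>m\<bar>" by (auto simp: \<K>_def)
      define x where "x = (j, nat \<bar>m\<bar>)"
      have x: "x \<in> X" using j m(1) by (auto simp: X_def x_def)
      have fx: "f x = pi * \<bar>real_of_int m\<bar> / l" by (simp add: f_def x_def l_def)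
      have "b * l / pi \<le> \<bar>real_of_int m\<bar>" using m(3) by linarith
      then have "b \<le> f x" using lpos by (simp add: fx field_simps)
      from near[OF x this] have pos: "0 < ev (N + rk x)"
        and dist: "\<bar>sqrt (ev (N + rk x)) - f x\<bar> \<le> B / f x" by auto
      have "\<sigma> (j, m) = sgn m * int (N + rk x)"
        using \<sigma>\<tau>[of "(j, m)"] that m by (simp add: \<tau>_def x_def \<K>_def)
      moreover have "rk x \<ge> 1" using bij_betw_apply[OF rk x] by simp
      ultimately have "eigenfrequency ev (\<sigma> (j, m)) = of_int (sgn m) * of_real (sqrt (ev (N + rk x)))"
        using eigenfrequency_of_positive[of ev "N + rk x" m] pos m(1) by simp
      \<comment> \<open>Both frequencies are odd in \<open>m\<close>, so the common sign factors out
        and the estimate reduces to the positive ones.\<close>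
      moreover have "complex_of_real (pi * real_of_int m / l) = of_int (sgn m) * of_real (f x)"
      proof -
        have "real_of_int m = of_int (sgn m) * \<bar>real_of_int m\<bar>" by (simp add: sgn_if)
        then have "pi * real_of_int m / l = of_int (sgn m) * f x" by (simp add: fx)
        then show ?thesis by (metis of_real_mult of_real_of_int_eq)
      qed
      ultimately have eq: "eigenfrequency ev (\<sigma> (j, m)) - complex_of_real (pi * real_of_int m / l)
          = of_int (sgn m) * of_real (sqrt (ev (N + rk x)) - f x)"
        by (simp add: algebra_simps)
      have "cmod (of_int (sgn m)) = 1" using m(1) by (simp add: sgn_if)
      then have "cmod (eigenfrequency ev (\<sigma> (j, m)) - complex_of_real (pi * real_of_int m / l))
          = \<bar>sqrt (ev (N + rk x)) - f x\<bar>"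
        by (simp only: eq norm_mult norm_of_real mult_1_left)
      also have "\<dots> \<le> B / f x" by (rule dist)
      also have "\<dots> = B * l / pi * (1 / \<bar>real_of_int m\<bar>)" by (simp add: fx)
      finally show "norm (cmod (eigenfrequency ev (\<sigma> (j, m))
          - complex_of_real (pi * real_of_int m / (a (Suc j) - a j))))
        \<le> B * (a (Suc j) - a j) / pi * norm (1 / \<bar>real_of_int m\<bar>)" by (simp add: l_def)
    qed
  qed
  with \<sigma> show ?thesis by blast
qed

end
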